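(* Let $k$ be a field, $U$ a $k$-algebra, and $M$ a $U$-module that is finite dimensional over $k$. Let $E=\mathrm{End}_U(M)$, and assume that for each indecomposable direct summand $M'$ of $M$ we have $E'/\mathrm{Rad}\,E'\simeq k$, where $E'=\mathrm{End}_U(M')$. Then $$\frac{E}{\mathrm{Rad}\,E}\simeq\bigoplus_iM_{d_i}(k),$$ where $M_d(k)$ is the algebra of $d\times d$ matrices over $k$, $i$ runs over the isomorphism classes of indecomposable $U$-modules (only finitely many of which occur), and the $d_i$ are the multiplicities of the corresponding indecomposable summands in a decomposition of $M$ into indecomposables.
   Context: $\mathrm{Rad}$ denotes the (Jacobson) radical of a finite dimensional algebra. By the Krull–Schmidt theorem the multiplicities $d_i$ are well defined; terms with $d_i=0$ contribute nothing. *)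

theory Defs
  imports "HOL-Algebra.Algebra" "Jordan_Normal_Form.Missing_VectorSpace"
begin

text \<open>
  The locales \<open>algebra\<close> and \<open>module\<close> of HOL-Algebra cover only commutative algebras and modules
  over commutative rings, so associative unital algebras and left modules over arbitrary rings are
  introduced here.  Modules are records of type \<^typ>\<open>('b, 'c) module\<close>; as in HOL-Algebra, their
  multiplicative fields are ignored.
\<close>

locale unital_algebra = module K A + A?: ring A
  for K (structure) and A (structure) +
  assumes smult_mult_left:
      "\<lbrakk>a \<in> carrier K; x \<in> carrier A; y \<in> carrier A\<rbrakk>
        \<Longrightarrow> (a \<odot>\<^bsub>A\<^esub> x) \<otimes>\<^bsub>A\<^esub> y = a \<odot>\<^bsub>A\<^esub> (x \<otimes>\<^bsub>A\<^esub> y)"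
    and smult_mult_right:
      "\<lbrakk>a \<in> carrier K; x \<in> carrier A; y \<in> carrier A\<rbrakk>
        \<Longrightarrow> x \<otimes>\<^bsub>A\<^esub> (a \<odot>\<^bsub>A\<^esub> y) = a \<odot>\<^bsub>A\<^esub> (x \<otimes>\<^bsub>A\<^esub> y)"

locale left_module = U?: ring U + M?: abelian_group M
  for U :: "('u, 'x) ring_scheme" (structure) and M :: "('u, 'c, 'y) module_scheme" (structure) +
  assumes act_closed: "\<lbrakk>u \<in> carrier U; x \<in> carrier M\<rbrakk> \<Longrightarrow> u \<odot>\<^bsub>M\<^esub> x \<in> carrier M"
    and act_l_distr: "\<lbrakk>u \<in> carrier U; v \<in> carrier U; x \<in> carrier M\<rbrakk>
        \<Longrightarrow> (u \<oplus>\<^bsub>U\<^esub> v) \<odot>\<^bsub>M\<^esub> x = u \<odot>\<^bsub>M\<^esub> x \<oplus>\<^bsub>M\<^esub> v \<odot>\<^bsub>M\<^esub> x"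
    and act_r_distr: "\<lbrakk>u \<in> carrier U; x \<in> carrier M; y \<in> carrier M\<rbrakk>
        \<Longrightarrow> u \<odot>\<^bsub>M\<^esub> (x \<oplus>\<^bsub>M\<^esub> y) = u \<odot>\<^bsub>M\<^esub> x \<oplus>\<^bsub>M\<^esub> u \<odot>\<^bsub>M\<^esub> y"
    and act_assoc: "\<lbrakk>u \<in> carrier U; v \<in> carrier U; x \<in> carrier M\<rbrakk>
        \<Longrightarrow> (u \<otimes>\<^bsub>U\<^esub> v) \<odot>\<^bsub>M\<^esub> x = u \<odot>\<^bsub>M\<^esub> (v \<odot>\<^bsub>M\<^esub> x)"
    and act_one: "x \<in> carrier M \<Longrightarrow> \<one>\<^bsub>U\<^esub> \<odot>\<^bsub>M\<^esub> x = x"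

text \<open>A module over a \<open>K\<close>-algebra \<open>U\<close> is a \<open>K\<close>-space via \<open>a x = (a 1) x\<close>, where \<open>1\<close> is the unit of \<open>U\<close>.\<close>

definition scalar_act ::
    "('b, 'u, 'x) module_scheme \<Rightarrow> ('u, 'c, 'y) module_scheme \<Rightarrow> 'b \<Rightarrow> 'c \<Rightarrow> 'c" where
  "scalar_act U M a x = (a \<odot>\<^bsub>U\<^esub> \<one>\<^bsub>U\<^esub>) \<odot>\<^bsub>M\<^esub> x"

definition restrict_scalars ::
    "('b, 'u, 'x) module_scheme \<Rightarrow> ('u, 'c, 'y) module_scheme \<Rightarrow> ('b, 'c) module" where
  "restrict_scalars U M =
    \<lparr>carrier = carrier M, monoid.mult = monoid.mult M, one = \<one>\<^bsub>M\<^esub>,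
     ring.zero = \<zero>\<^bsub>M\<^esub>, ring.add = ring.add M,
     smult = scalar_act U M\<rparr>"

definition left_submodule ::
    "('u, 'x) ring_scheme \<Rightarrow> ('u, 'c, 'y) module_scheme \<Rightarrow> 'c set \<Rightarrow> bool" where
  "left_submodule U M N \<longleftrightarrow>
    additive_subgroup N M \<and> (\<forall>u\<in>carrier U. \<forall>x\<in>N. u \<odot>\<^bsub>M\<^esub> x \<in> N)"

definition complementary_submodules ::
    "('u, 'x) ring_scheme \<Rightarrow> ('u, 'c, 'y) module_scheme \<Rightarrow> 'c set \<Rightarrow> 'c set \<Rightarrow> bool" where
  "complementary_submodules U M A B \<longleftrightarrow>
    left_submodule U M A \<and> left_submodule U M B \<and>
    A <+>\<^bsub>M\<^esub> B = carrier M \<and> A \<inter> B = {\<zero>\<^bsub>M\<^esub>}"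

definition direct_summand ::
    "('u, 'x) ring_scheme \<Rightarrow> ('u, 'c, 'y) module_scheme \<Rightarrow> 'c set \<Rightarrow> bool" where
  "direct_summand U M A \<longleftrightarrow> (\<exists>B. complementary_submodules U M A B)"

definition indecomposable ::
    "('u, 'x) ring_scheme \<Rightarrow> ('u, 'c, 'y) module_scheme \<Rightarrow> bool" where
  "indecomposable U M \<longleftrightarrow>
    left_module U M \<and> carrier M \<noteq> {\<zero>\<^bsub>M\<^esub>} \<and>
    (\<forall>A B. complementary_submodules U M A B \<longrightarrow> A = {\<zero>\<^bsub>M\<^esub>} \<or> B = {\<zero>\<^bsub>M\<^esub>})"

definition module_isomorphic ::
    "('u, 'x) ring_scheme \<Rightarrow> ('u, 'c, 'y) module_scheme \<Rightarrow> ('u, 'd, 'z) module_scheme \<Rightarrow> bool" where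
  "module_isomorphic U M N \<longleftrightarrow>
    (\<exists>f\<in>module_hom U M N. bij_betw f (carrier M) (carrier N))"

text \<open>
  The isomorphism classes of those indecomposable \<open>U\<close>-modules whose elements are of type \<open>'c\<close>.
  For a module \<open>M\<close> with elements of type \<open>'c\<close> these include every class occurring in \<open>M\<close>.
\<close>

definition indecomposable_classes :: "('u, 'x) ring_scheme \<Rightarrow> ('u, 'c) module set set" where
  "indecomposable_classes U =
    {N. indecomposable U N} //
    {(N, N'). indecomposable U N \<and> indecomposable U N' \<and> module_isomorphic U N N'}"

definition decomposition_into_indecomposables ::
    "('u, 'x) ring_scheme \<Rightarrow> ('u, 'c) module \<Rightarrow> nat \<Rightarrow> (nat \<Rightarrow> 'c set) \<Rightarrow> bool" where
  "decomposition_into_indecomposables U M n N \<longleftrightarrow>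
    (\<forall>j<n. left_submodule U M (N j) \<and> indecomposable U (M\<lparr>carrier := N j\<rparr>)) \<and>
    bij_betw (\<lambda>x. finsum M x {..<n}) (\<Pi>\<^sub>E j\<in>{..<n}. N j) (carrier M)"

definition multiplicity_in ::
    "('u, 'c) module \<Rightarrow> nat \<Rightarrow> (nat \<Rightarrow> 'c set) \<Rightarrow> ('u, 'c) module set \<Rightarrow> nat" where
  "multiplicity_in M n N i = card {j. j < n \<and> M\<lparr>carrier := N j\<rparr> \<in> i}"

text \<open>Endomorphisms are made extensional, so that equality is equality on the carrier.\<close>

definition End_algebra ::
    "('b, 'u, 'x) module_scheme \<Rightarrow> ('u, 'c, 'y) module_scheme \<Rightarrow> ('b, 'c \<Rightarrow> 'c) module" where
  "End_algebra U M =
    \<lparr>carrier = module_hom U M M \<inter> extensional (carrier M),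
     monoid.mult = (\<lambda>f g. \<lambda>x\<in>carrier M. f (g x)),
     one = (\<lambda>x\<in>carrier M. x),
     ring.zero = (\<lambda>x\<in>carrier M. \<zero>\<^bsub>M\<^esub>),
     ring.add = (\<lambda>f g. \<lambda>x\<in>carrier M. f x \<oplus>\<^bsub>M\<^esub> g x),
     smult = (\<lambda>a f. \<lambda>x\<in>carrier M. scalar_act U M a (f x))\<rparr>"

definition left_ideal :: "'e set \<Rightarrow> ('e, 'x) ring_scheme \<Rightarrow> bool" where
  "left_ideal I R \<longleftrightarrow>
    additive_subgroup I R \<and> (\<forall>r\<in>carrier R. \<forall>x\<in>I. r \<otimes>\<^bsub>R\<^esub> x \<in> I)"

definition maximal_left_ideal :: "'e set \<Rightarrow> ('e, 'x) ring_scheme \<Rightarrow> bool" where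
  "maximal_left_ideal I R \<longleftrightarrow>
    left_ideal I R \<and> I \<noteq> carrier R \<and>
    (\<forall>J. left_ideal J R \<and> I \<subseteq> J \<longrightarrow> J = I \<or> J = carrier R)"

text \<open>The Jacobson radical; in the zero ring, which has no maximal left ideal, it is the whole ring.\<close>

definition Rad :: "('e, 'x) ring_scheme \<Rightarrow> 'e set" where
  "Rad R = carrier R \<inter> \<Inter>{I. maximal_left_ideal I R}"

definition quotient_algebra ::
    "('b, 'e, 'x) module_scheme \<Rightarrow> 'e set \<Rightarrow> ('b, 'e set) module" where
  "quotient_algebra A I =
    \<lparr>carrier = carrier (A Quot I), monoid.mult = monoid.mult (A Quot I), one = \<one>\<^bsub>A Quot I\<^esub>,
     ring.zero = \<zero>\<^bsub>A Quot I\<^esub>, ring.add = ring.add (A Quot I),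
     smult = (\<lambda>a S. \<Union>x\<in>S. I +>\<^bsub>A\<^esub> (a \<odot>\<^bsub>A\<^esub> x))\<rparr>"

definition algebra_isomorphic ::
    "('b, 'k) ring_scheme \<Rightarrow> ('b, 'e, 'x) module_scheme \<Rightarrow> ('b, 'f, 'y) module_scheme \<Rightarrow> bool" where
  "algebra_isomorphic K A B \<longleftrightarrow>
    (\<exists>h\<in>ring_iso A B. \<forall>a\<in>carrier K. \<forall>x\<in>carrier A. h (a \<odot>\<^bsub>A\<^esub> x) = a \<odot>\<^bsub>B\<^esub> h x)"

definition base_algebra :: "('b, 'k) ring_scheme \<Rightarrow> ('b, 'b) module" where
  "base_algebra K =
    \<lparr>carrier = carrier K, monoid.mult = monoid.mult K, one = \<one>\<^bsub>K\<^esub>,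
     ring.zero = \<zero>\<^bsub>K\<^esub>, ring.add = ring.add K, smult = monoid.mult K\<rparr>"

text \<open>
  The carrier-based algebra of \<open>d \<times> d\<close> matrices with entries indexed by \<open>{..<d} \<times> {..<d}\<close>;
  for \<open>d = 0\<close> it is the zero ring.
\<close>

definition matrix_algebra :: "('b, 'k) ring_scheme \<Rightarrow> nat \<Rightarrow> ('b, nat \<times> nat \<Rightarrow> 'b) module" where
  "matrix_algebra K d =
    \<lparr>carrier = {..<d} \<times> {..<d} \<rightarrow>\<^sub>E carrier K,
     monoid.mult = (\<lambda>A B. \<lambda>(r, s)\<in>{..<d} \<times> {..<d}. \<Oplus>\<^bsub>K\<^esub>t\<in>{..<d}. A (r, t) \<otimes>\<^bsub>K\<^esub> B (t, s)),
     one = (\<lambda>(r, s)\<in>{..<d} \<times> {..<d}. if r = s then \<one>\<^bsub>K\<^esub> else \<zero>\<^bsub>K\<^esub>),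
     ring.zero = (\<lambda>p\<in>{..<d} \<times> {..<d}. \<zero>\<^bsub>K\<^esub>),
     ring.add = (\<lambda>A B. \<lambda>p\<in>{..<d} \<times> {..<d}. A p \<oplus>\<^bsub>K\<^esub> B p),
     smult = (\<lambda>a A. \<lambda>p\<in>{..<d} \<times> {..<d}. a \<otimes>\<^bsub>K\<^esub> A p)\<rparr>"

text \<open>
  Finitely supported families with componentwise operations.  The unit lies in the carrier when all
  but finitely many of the summands are zero.
\<close>

definition direct_sum_algebra ::
    "'i set \<Rightarrow> ('i \<Rightarrow> ('b, 'e, 'x) module_scheme) \<Rightarrow> ('b, 'i \<Rightarrow> 'e) module" where
  "direct_sum_algebra I A =
    \<lparr>carrier = {f \<in> \<Pi>\<^sub>E i\<in>I. carrier (A i). finite {i \<in> I. f i \<noteq> \<zero>\<^bsub>A i\<^esub>}},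
     monoid.mult = (\<lambda>f g. \<lambda>i\<in>I. f i \<otimes>\<^bsub>A i\<^esub> g i),
     one = (\<lambda>i\<in>I. \<one>\<^bsub>A i\<^esub>),
     ring.zero = (\<lambda>i\<in>I. \<zero>\<^bsub>A i\<^esub>),
     ring.add = (\<lambda>f g. \<lambda>i\<in>I. f i \<oplus>\<^bsub>A i\<^esub> g i),
     smult = (\<lambda>a f. \<lambda>i\<in>I. a \<odot>\<^bsub>A i\<^esub> f i)\<rparr>"

end

theory Submission
  imports Defs
begin

text \<open>
  Let \<open>M = N 0 \<oplus> \<dots> \<oplus> N (n - 1)\<close> with indecomposable \<open>N j\<close>, and let \<open>e j \<in> E\<close> be the projection
  onto \<open>N j\<close>.  Composing the quotient maps \<open>End (N j) \<rightarrow> End (N j) / Rad \<simeq> k\<close> with transport along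
  chosen isomorphisms between isomorphic summands turns \<open>f \<in> E\<close> into a family of scalars \<open>entry a b f\<close>,
  indexed by the pairs \<open>a, b\<close> with \<open>N a \<simeq> N b\<close>.  A composite \<open>N a \<rightarrow> N b \<rightarrow> N a\<close> has residue zero
  unless \<open>N a \<simeq> N b\<close>, so the scalars multiply like block matrices, and every family of scalars occurs.
  The common kernel of the entries is \<open>Rad E\<close>: matrices with a vanishing column form a maximal left
  ideal, and an element congruent to 1 modulo the kernel is left invertible by Gaussian elimination,
  its diagonal entries being invertible.
\<close>

section \<open>Left ideals and the Jacobson radical\<close>

text \<open>That residues vanish between non-isomorphic summands rests on the triviality of
  idempotents in a local ring. A composite \<open>N a -> N b -> N a\<close> with nonzero residue is
  left invertible, so \<open>N a\<close> is a retract of \<open>N b\<close>; the resulting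
  idempotent of \<open>End (N b)\<close> is 0 or 1, and it cannot be 0. The matrix argument is
  carried out in an abstract algebra with orthogonal idempotents \<open>e j\<close> of sum 1. The
  residue maps \<open>\<psi> j\<close> live on the whole algebra (the residue of the compression to
  \<open>e j\<close>), so corner rings never appear there as separate structures; the price is an
  inserted \<open>e j\<close> in the multiplication law. All entries of one isomorphism class are
  read at a single representative. Reading each at its own summand would require comparing the
  residue maps of different summands whenever two entries are multiplied. The radical is given by
  maximal left ideals, so invertibility is used in its left-sided form: left inverses lift from the
  quotient by \<open>Rad\<close>, and \<open>x\<close> lies in \<open>Rad\<close> as soon as every
  \<open>\<one> \<ominus> r \<otimes> x\<close> has a left inverse.\<close>

context ring
begin

text \<open>Closure under negation comes for free, because negation is left multiplication by
  \<open>\<ominus> \<one>\<close>.\<close>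

lemma left_idealI:
  assumes "I \<subseteq> carrier R" and "\<zero> \<in> I"
    and "\<And>x y. \<lbrakk>x \<in> I; y \<in> I\<rbrakk> \<Longrightarrow> x \<oplus> y \<in> I"
    and "\<And>r x. \<lbrakk>r \<in> carrier R; x \<in> I\<rbrakk> \<Longrightarrow> r \<otimes> x \<in> I"
  shows "left_ideal I R"
proof -
  have "\<ominus> x \<in> I" if "x \<in> I" for x
    using assms(4)[of "\<ominus> \<one>" x] that assms(1) by (auto simp: l_minus)
  then have "subgroup I (add_monoid R)"
    using assms(1-3) by (intro subgroup.intro) (auto simp: a_inv_def)
  then show ?thesis
    using assms(4) by (auto simp: left_ideal_def additive_subgroup_def)
qed

lemma left_ideal_subset: "left_ideal I R \<Longrightarrow> I \<subseteq> carrier R"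
  by (auto simp: left_ideal_def dest: additive_subgroup.a_subset)

lemma left_ideal_zero: "left_ideal I R \<Longrightarrow> \<zero> \<in> I"
  by (auto simp: left_ideal_def additive_subgroup.zero_closed)

lemma left_ideal_add: "\<lbrakk>left_ideal I R; x \<in> I; y \<in> I\<rbrakk> \<Longrightarrow> x \<oplus> y \<in> I"
  by (auto simp: left_ideal_def additive_subgroup.a_closed)

lemma left_ideal_mult: "\<lbrakk>left_ideal I R; r \<in> carrier R; x \<in> I\<rbrakk> \<Longrightarrow> r \<otimes> x \<in> I"
  by (auto simp: left_ideal_def)

lemma left_ideal_one: "\<lbrakk>left_ideal I R; \<one> \<in> I\<rbrakk> \<Longrightarrow> I = carrier R"
  using left_ideal_subset[of I] left_ideal_mult[of I _ \<one>] by force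

lemma maximal_left_ideal_one: "maximal_left_ideal I R \<Longrightarrow> \<one> \<notin> I"
  using left_ideal_one by (auto simp: maximal_left_ideal_def)

text \<open>This is \<open>I + R x\<close>, the left ideal against which the maximality of
  \<open>I\<close> is tested.\<close>

lemma left_ideal_sum_principal:
  assumes I: "left_ideal I R" and x: "x \<in> carrier R"
  shows "left_ideal {a \<oplus> r \<otimes> x | a r. a \<in> I \<and> r \<in> carrier R} R" (is "left_ideal ?J R")
    and "I \<subseteq> {a \<oplus> r \<otimes> x | a r. a \<in> I \<and> r \<in> carrier R}"
    and "x \<in> {a \<oplus> r \<otimes> x | a r. a \<in> I \<and> r \<in> carrier R}"
proof -
  note sub = subsetD[OF left_ideal_subset[OF I]]
  show inI: "I \<subseteq> ?J"
  proof
    fix a assume "a \<in> I"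
    then have "a = a \<oplus> \<zero> \<otimes> x" using x sub by simp
    then show "a \<in> ?J" using \<open>a \<in> I\<close> by blast
  qed
  have "x = \<zero> \<oplus> \<one> \<otimes> x" using x by simp
  then show "x \<in> ?J" using left_ideal_zero[OF I] by blast
  show "left_ideal ?J R"
  proof (rule left_idealI)
    show "?J \<subseteq> carrier R" using x sub by auto
    show "\<zero> \<in> ?J" using inI left_ideal_zero[OF I] by blast
  next
    fix y z assume "y \<in> ?J" "z \<in> ?J"
    then obtain a r b s where *: "a \<in> I" "r \<in> carrier R" "y = a \<oplus> r \<otimes> x"
        "b \<in> I" "s \<in> carrier R" "z = b \<oplus> s \<otimes> x" by blast
    then have "y \<oplus> z = (a \<oplus> b) \<oplus> (r \<oplus> s) \<otimes> x"
      using x sub by (simp add: l_distr a_ac)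
    then show "y \<oplus> z \<in> ?J" using * left_ideal_add[OF I] by blast
  next
    fix t y assume t: "t \<in> carrier R" "y \<in> ?J"
    then obtain a r where *: "a \<in> I" "r \<in> carrier R" "y = a \<oplus> r \<otimes> x" by blast
    then have "t \<otimes> y = t \<otimes> a \<oplus> (t \<otimes> r) \<otimes> x"
      using x sub t by (simp add: r_distr m_assoc)
    then show "t \<otimes> y \<in> ?J" using * t left_ideal_mult[OF I] by blast
  qed
qed

lemma maximal_left_ideal_comaximal:
  assumes "maximal_left_ideal I R" and "x \<in> carrier R" and "x \<notin> I"
  obtains a r where "a \<in> I" "r \<in> carrier R" "\<one> = a \<oplus> r \<otimes> x"
proof -
  have I: "left_ideal I R" using assms(1) by (simp add: maximal_left_ideal_def)
  have "{a \<oplus> r \<otimes> x | a r. a \<in> I \<and> r \<in> carrier R} = carrier R"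
    using left_ideal_sum_principal[OF I assms(2)] assms
    unfolding maximal_left_ideal_def by blast
  then show ?thesis using that one_closed by blast
qed

text \<open>A left ideal strictly above \<open>I\<close> contains some \<open>x\<close> outside
  \<open>I\<close>, hence both \<open>r \<otimes> x\<close> and
  \<open>\<one> \<ominus> r \<otimes> x\<close>, hence \<open>\<one>\<close>.\<close>

lemma maximal_left_idealI:
  assumes "left_ideal I R" and "\<one> \<notin> I"
    and "\<And>x. \<lbrakk>x \<in> carrier R; x \<notin> I\<rbrakk> \<Longrightarrow> \<exists>r\<in>carrier R. \<one> \<ominus> r \<otimes> x \<in> I"
  shows "maximal_left_ideal I R"
  unfolding maximal_left_ideal_def
proof (intro conjI allI impI)
  show "I \<noteq> carrier R" using assms(2) by auto
  fix J assume J: "left_ideal J R \<and> I \<subseteq> J"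
  show "J = I \<or> J = carrier R"
  proof (cases "J \<subseteq> I")
    case False
    then obtain x where x: "x \<in> J" "x \<notin> I" by blast
    then have xc: "x \<in> carrier R" using J left_ideal_subset by blast
    with x assms(3) obtain r where r: "r \<in> carrier R" "\<one> \<ominus> r \<otimes> x \<in> I" by blast
    have "(\<one> \<ominus> r \<otimes> x) \<oplus> r \<otimes> x \<in> J"
      using J r x by (blast intro: left_ideal_add left_ideal_mult)
    moreover have "(\<one> \<ominus> r \<otimes> x) \<oplus> r \<otimes> x = \<one>"
      using r xc by (simp add: a_minus_def a_assoc l_neg)
    ultimately show ?thesis using left_ideal_one J by metis
  qed (use J in blast)
qed (fact assms(1))

lemma proper_left_ideal_in_maximal:
  assumes I: "left_ideal I R" and one: "\<one> \<notin> I"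
  obtains J where "maximal_left_ideal J R" "I \<subseteq> J"
proof -
  \<comment> \<open>Properness is expressed as \<open>\<one> \<notin> J\<close> because this form
    passes to unions of chains.\<close>
  define A where "A = {J. left_ideal J R \<and> \<one> \<notin> J \<and> I \<subseteq> J}"
  have "\<exists>K\<in>A. \<forall>L\<in>C. L \<subseteq> K" if C: "subset.chain A C" for C
  proof (cases "C = {}")
    case True
    then show ?thesis using I one by (auto simp: A_def)
  next
    case False
    have CA: "left_ideal L R \<and> \<one> \<notin> L \<and> I \<subseteq> L" if "L \<in> C" for L
      using C that by (auto simp: subset.chain_def A_def)
    have "left_ideal (\<Union>C) R"
    proof (rule left_idealI)
      show "\<Union>C \<subseteq> carrier R" using CA left_ideal_subset by blast
      show "\<zero> \<in> \<Union>C" using CA False left_ideal_zero by blast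
    next
      fix x y assume "x \<in> \<Union>C" "y \<in> \<Union>C"
      then obtain K L where XY: "K \<in> C" "L \<in> C" "x \<in> K" "y \<in> L" by blast
      then have "K \<subseteq> L \<or> L \<subseteq> K" using C by (auto simp: subset.chain_def)
      then obtain Z where "Z \<in> C" "x \<in> Z" "y \<in> Z" using XY by blast
      moreover have "left_ideal Z R" using \<open>Z \<in> C\<close> CA by blast
      ultimately show "x \<oplus> y \<in> \<Union>C" using left_ideal_add by blast
    next
      fix r x assume "r \<in> carrier R" "x \<in> \<Union>C"
      then show "r \<otimes> x \<in> \<Union>C" using CA left_ideal_mult by blast
    qed
    then have "\<Union>C \<in> A" using CA False unfolding A_def by blast
    then show ?thesis by blast
  qed
  then obtain J where J: "J \<in> A" "\<And>K. \<lbrakk>K \<in> A; J \<subseteq> K\<rbrakk> \<Longrightarrow> K = J"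
    using subset_Zorn[of A] by metis
  have "K = J \<or> K = carrier R" if "left_ideal K R" "J \<subseteq> K" for K
  proof (cases "\<one> \<in> K")
    case True
    then show ?thesis using left_ideal_one that by blast
  next
    case False
    then have "K \<in> A" using that J(1) by (auto simp: A_def)
    then show ?thesis using J(2) that by blast
  qed
  then have "maximal_left_ideal J R"
    using J(1) by (auto simp: A_def maximal_left_ideal_def)
  then show ?thesis using that J(1) by (auto simp: A_def)
qed

lemma left_ideal_Inter_carrier:
  assumes "\<And>I. I \<in> S \<Longrightarrow> left_ideal I R"
  shows "left_ideal (carrier R \<inter> \<Inter>S) R"
  by (rule left_idealI)
    (use assms left_ideal_zero left_ideal_add left_ideal_mult in auto)

lemma left_ideal_Rad: "left_ideal (Rad R) R"
  unfolding Rad_def by (rule left_ideal_Inter_carrier) (simp add: maximal_left_ideal_def)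

lemma Rad_subset: "Rad R \<subseteq> carrier R"
  by (simp add: Rad_def)

text \<open>The set is the kernel of the map \<open>R -> R/I\<close> sending \<open>y\<close> to the
  class of \<open>y \<otimes> r\<close>. As \<open>R/I\<close> is simple and \<open>r\<close> is
  nonzero in it, the kernel is again a maximal left ideal. This is what makes the radical
  two-sided.\<close>

lemma maximal_left_ideal_colon:
  assumes "maximal_left_ideal I R" and r: "r \<in> carrier R" "r \<notin> I"
  shows "maximal_left_ideal {y \<in> carrier R. y \<otimes> r \<in> I} R" (is "maximal_left_ideal ?J R")
proof (rule maximal_left_idealI)
  have I: "left_ideal I R" using assms(1) by (simp add: maximal_left_ideal_def)
  show "left_ideal ?J R"
    by (rule left_idealI)
      (auto simp: r l_distr m_assoc left_ideal_zero[OF I] left_ideal_add[OF I] left_ideal_mult[OF I])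
  show "\<one> \<notin> ?J" using r by auto
  fix y assume y: "y \<in> carrier R" "y \<notin> ?J"
  then obtain a z where az: "a \<in> I" "z \<in> carrier R" "\<one> = a \<oplus> z \<otimes> (y \<otimes> r)"
    using maximal_left_ideal_comaximal[OF assms(1), of "y \<otimes> r"] r by auto
  have ac: "a \<in> carrier R" using az left_ideal_subset[OF I] by blast
  \<comment> \<open>Multiplying \<open>\<one> = a \<oplus> z \<otimes> (y \<otimes> r)\<close> by
    \<open>r\<close> on the left shows that \<open>r \<otimes> z\<close> inverts \<open>y\<close>
    modulo the new ideal: the defect \<open>\<one> \<ominus> (r \<otimes> z) \<otimes> y\<close> is
    sent to \<open>r \<otimes> a\<close>, which lies in \<open>I\<close>.\<close>
  have "r = r \<otimes> \<one>" using r by simp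
  also have "\<dots> = r \<otimes> a \<oplus> (r \<otimes> z) \<otimes> y \<otimes> r"
    unfolding az(3) using az(2) ac r y by (simp add: r_distr m_assoc)
  finally have "(\<one> \<ominus> (r \<otimes> z) \<otimes> y) \<otimes> r = r \<otimes> a \<oplus> (r \<otimes> z) \<otimes> y \<otimes> r \<ominus> (r \<otimes> z) \<otimes> y \<otimes> r"
    using r y az(2) by (simp add: a_minus_def l_distr l_minus)
  also have "\<dots> = r \<otimes> a"
    using r y az(2) ac by (simp add: a_minus_def a_assoc r_neg)
  finally have "(\<one> \<ominus> (r \<otimes> z) \<otimes> y) \<otimes> r \<in> I"
    using left_ideal_mult[OF I r(1) az(1)] by simp
  then show "\<exists>s\<in>carrier R. \<one> \<ominus> s \<otimes> y \<in> ?J"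
    using r y az(2) by (intro bexI[of _ "r \<otimes> z"]) auto
qed

text \<open>For multiplication on the right by \<open>x\<close>, an element of the radical is tested
  against the maximal left ideal \<open>{y. y \<otimes> x \<in> I}\<close> instead of
  \<open>I\<close>.\<close>

lemma ideal_Rad: "ideal (Rad R) R"
proof (rule idealI)
  show "ring R" by (rule ring_axioms)
  show "subgroup (Rad R) (add_monoid R)"
    using left_ideal_Rad by (simp add: left_ideal_def additive_subgroup_def)
next
  fix a x assume "a \<in> Rad R" "x \<in> carrier R"
  then show "x \<otimes> a \<in> Rad R" by (intro left_ideal_mult[OF left_ideal_Rad])
next
  fix a x assume a: "a \<in> Rad R" and x: "x \<in> carrier R"
  have ac: "a \<in> carrier R" using a Rad_subset by blast
  have "a \<otimes> x \<in> I" if I: "maximal_left_ideal I R" for I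
  proof (cases "x \<in> I")
    case True
    then show ?thesis using I ac left_ideal_mult by (auto simp: maximal_left_ideal_def)
  next
    case False
    then have "a \<in> {y \<in> carrier R. y \<otimes> x \<in> I}"
      using maximal_left_ideal_colon[OF I x] a unfolding Rad_def by blast
    then show ?thesis by simp
  qed
  then show "a \<otimes> x \<in> Rad R" using ac x by (auto simp: Rad_def)
qed

text \<open>If \<open>x\<close> avoided a maximal left ideal \<open>I\<close>, comaximality would
  place some \<open>\<one> \<ominus> r \<otimes> x\<close> in \<open>I\<close>, and a left inverse
  of it would put \<open>\<one>\<close> there.\<close>

lemma mem_RadI:
  assumes "x \<in> carrier R"
    and "\<And>r. r \<in> carrier R \<Longrightarrow> \<exists>s\<in>carrier R. s \<otimes> (\<one> \<ominus> r \<otimes> x) = \<one>"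
  shows "x \<in> Rad R"
proof -
  have "x \<in> I" if I: "maximal_left_ideal I R" for I
  proof (rule ccontr)
    have lI: "left_ideal I R" using I by (simp add: maximal_left_ideal_def)
    assume "x \<notin> I"
    then obtain a r where ar: "a \<in> I" "r \<in> carrier R" "\<one> = a \<oplus> r \<otimes> x"
      using maximal_left_ideal_comaximal[OF I assms(1)] by blast
    have "a \<in> carrier R" using ar(1) left_ideal_subset[OF lI] by blast
    then have "\<one> \<ominus> r \<otimes> x = a"
      unfolding ar(3) using ar(2) assms(1) by (simp add: a_minus_def a_assoc r_neg)
    then obtain s where "s \<in> carrier R" "s \<otimes> a = \<one>" using assms(2)[OF ar(2)] by auto
    then show False using left_ideal_mult[OF lI _ ar(1)] maximal_left_ideal_one[OF I] by metis
  qed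
  then show ?thesis using assms(1) by (auto simp: Rad_def)
qed

text \<open>If \<open>R x\<close> were proper, a maximal left ideal above it would contain
  \<open>g \<otimes> x\<close> and also \<open>\<one> \<ominus> g \<otimes> x\<close>, hence
  \<open>\<one>\<close>. Left inverses therefore lift from the quotient by the radical.\<close>

lemma left_invertible_mod_Rad:
  assumes x: "x \<in> carrier R" and g: "g \<in> carrier R" and "\<one> \<ominus> g \<otimes> x \<in> Rad R"
  shows "\<exists>y\<in>carrier R. y \<otimes> x = \<one>"
proof (rule ccontr)
  assume no: "\<not> ?thesis"
  define I where "I = {r \<otimes> x | r. r \<in> carrier R}"
  have I: "left_ideal I R"
  proof (rule left_idealI)
    show "I \<subseteq> carrier R" using x by (auto simp: I_def)
    show "\<zero> \<in> I" using x by (auto simp: I_def intro!: exI[of _ \<zero>])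
  next
    fix y z assume "y \<in> I" "z \<in> I"
    then obtain r s where "r \<in> carrier R" "y = r \<otimes> x" "s \<in> carrier R" "z = s \<otimes> x"
      by (auto simp: I_def)
    then show "y \<oplus> z \<in> I" using x by (auto simp: I_def l_distr intro!: exI[of _ "r \<oplus> s"])
  next
    fix t y assume "t \<in> carrier R" "y \<in> I"
    then obtain r where "r \<in> carrier R" "y = r \<otimes> x" by (auto simp: I_def)
    then show "t \<otimes> y \<in> I" using x \<open>t \<in> carrier R\<close>
      by (auto simp: I_def m_assoc intro!: exI[of _ "t \<otimes> r"])
  qed
  have "\<one> \<notin> I" using no by (auto simp: I_def)
  then obtain J where J: "maximal_left_ideal J R" "I \<subseteq> J"
    using proper_left_ideal_in_maximal[OF I] by blast
  have lJ: "left_ideal J R" using J(1) by (simp add: maximal_left_ideal_def)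
  have "\<one> \<ominus> g \<otimes> x \<in> J" using assms(3) J(1) by (auto simp: Rad_def)
  moreover have "g \<otimes> x \<in> J" using J(2) g by (auto simp: I_def)
  ultimately have "(\<one> \<ominus> g \<otimes> x) \<oplus> g \<otimes> x \<in> J" by (rule left_ideal_add[OF lJ])
  moreover have "(\<one> \<ominus> g \<otimes> x) \<oplus> g \<otimes> x = \<one>"
    using g x by (simp add: a_minus_def a_assoc l_neg)
  ultimately show False using maximal_left_ideal_one[OF J(1)] by simp
qed

end

section \<open>Algebras with local diagonal corners\<close>

text \<open>The model is \<open>End_U(M)\<close> with the projections \<open>e j\<close>, where
  \<open>\<psi> j x\<close> is the residue of \<open>x\<close> compressed to the summand
  \<open>j\<close>. In \<open>psi_mult\<close> the middle \<open>e j\<close> discards the paths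
  through other summands. \<open>psi_unit\<close> is locality of the corner in left-sided
  form.\<close>

locale local_idempotents = F: field K + E: unital_algebra K A
  for A :: "('b, 'e, 'x) module_scheme" (structure) and K :: "('b, 'k) ring_scheme" (structure) +
  fixes n :: nat and e :: "nat \<Rightarrow> 'e" and \<psi> :: "nat \<Rightarrow> 'e \<Rightarrow> 'b"
  assumes e_closed [simp]: "j < n \<Longrightarrow> e j \<in> carrier A"
    and e_idem: "j < n \<Longrightarrow> e j \<otimes> e j = e j"
    and e_orth: "\<lbrakk>i < n; j < n; i \<noteq> j\<rbrakk> \<Longrightarrow> e i \<otimes> e j = \<zero>"
    and e_sum: "(\<Oplus>j\<in>{..<n}. e j) = \<one>"
    and psi_closed [simp]: "\<lbrakk>j < n; x \<in> carrier A\<rbrakk> \<Longrightarrow> \<psi> j x \<in> carrier K"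
    and psi_add: "\<lbrakk>j < n; x \<in> carrier A; y \<in> carrier A\<rbrakk>
        \<Longrightarrow> \<psi> j (x \<oplus> y) = \<psi> j x \<oplus>\<^bsub>K\<^esub> \<psi> j y"
    and psi_smult: "\<lbrakk>j < n; c \<in> carrier K; x \<in> carrier A\<rbrakk> \<Longrightarrow> \<psi> j (c \<odot> x) = c \<otimes>\<^bsub>K\<^esub> \<psi> j x"
    and psi_e: "j < n \<Longrightarrow> \<psi> j (e j) = \<one>\<^bsub>K\<^esub>"
    and psi_mult: "\<lbrakk>j < n; x \<in> carrier A; y \<in> carrier A\<rbrakk>
        \<Longrightarrow> \<psi> j (x \<otimes> e j \<otimes> y) = \<psi> j x \<otimes>\<^bsub>K\<^esub> \<psi> j y"
    and psi_unit: "\<lbrakk>j < n; x \<in> carrier A; \<psi> j x \<noteq> \<zero>\<^bsub>K\<^esub>\<rbrakk>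
        \<Longrightarrow> \<exists>y\<in>carrier A. y \<otimes> e j \<otimes> x \<otimes> e j = e j"
begin

text \<open>Isomorphism of the images of two projections, written inside the algebra:
  \<open>q\<close> leads from the image of \<open>e i\<close> to that of \<open>e j\<close>, and
  \<open>p\<close> is its inverse.\<close>

definition equivalent_idempotents :: "nat \<Rightarrow> nat \<Rightarrow> bool" where
  "equivalent_idempotents i j \<longleftrightarrow> (\<exists>p\<in>carrier A. \<exists>q\<in>carrier A.
    e i \<otimes> p = p \<and> p \<otimes> e j = p \<and> e j \<otimes> q = q \<and> q \<otimes> e i = q \<and> p \<otimes> q = e i \<and> q \<otimes> p = e j)"

lemma psi_minus: "\<lbrakk>j < n; x \<in> carrier A\<rbrakk> \<Longrightarrow> \<psi> j (\<ominus> x) = \<ominus>\<^bsub>K\<^esub> \<psi> j x"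
  using psi_smult[of j "\<ominus>\<^bsub>K\<^esub> \<one>\<^bsub>K\<^esub>" x] by (simp add: E.smult_l_minus F.l_minus)

lemma psi_zero [simp]: "j < n \<Longrightarrow> \<psi> j \<zero> = \<zero>\<^bsub>K\<^esub>"
  using psi_smult[of j "\<zero>\<^bsub>K\<^esub>" \<zero>] by simp

text \<open>By \<open>psi_unit\<close>, the corner of \<open>A\<close> at \<open>e j\<close> is a local ring.\<close>

lemma corner_idempotent_trivial:
  assumes j: "j < n" and x: "x \<in> carrier A" "e j \<otimes> x = x" "x \<otimes> e j = x" "x \<otimes> x = x"
  shows "x = \<zero> \<or> x = e j"
proof (cases "\<psi> j x = \<zero>\<^bsub>K\<^esub>")
  case True
  \<comment> \<open>One of \<open>x\<close> and \<open>e j \<ominus> x\<close> has nonzero residue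
    and is left invertible in the corner. Cancelling it from
    \<open>(e j \<ominus> x) \<otimes> x = \<zero>\<close> gives \<open>x = \<zero>\<close>; in the
    other case cancelling \<open>x\<close> from \<open>x \<otimes> x = x\<close> gives
    \<open>x = e j\<close>.\<close>
  then have "\<psi> j (e j \<ominus> x) \<noteq> \<zero>\<^bsub>K\<^esub>"
    using j x(1) by (simp add: a_minus_def psi_add psi_minus psi_e)
  then obtain z where z: "z \<in> carrier A" "z \<otimes> e j \<otimes> (e j \<ominus> x) \<otimes> e j = e j"
    using psi_unit[OF j, of "e j \<ominus> x"] j x(1) by auto
  have "(e j \<ominus> x) \<otimes> x = \<zero>"
    using j x by (simp add: a_minus_def E.A.l_distr E.A.l_minus E.M.r_neg)
  then have "z \<otimes> e j \<otimes> ((e j \<ominus> x) \<otimes> (e j \<otimes> x)) = \<zero>" using j z(1) x by simp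
  then have "(z \<otimes> e j \<otimes> (e j \<ominus> x) \<otimes> e j) \<otimes> x = \<zero>"
    using j x(1) z(1) by (simp add: E.A.m_assoc)
  then show ?thesis using z(2) x(2) by simp
next
  case False
  then obtain z where z: "z \<in> carrier A" "z \<otimes> e j \<otimes> x \<otimes> e j = e j"
    using psi_unit[OF j x(1)] by auto
  then have zx: "z \<otimes> x = e j" using j x by (simp add: E.A.m_assoc)
  have "x = (z \<otimes> x) \<otimes> x" using zx x by simp
  also have "\<dots> = z \<otimes> (x \<otimes> x)" using z(1) x(1) by (simp only: E.A.m_assoc)
  also have "\<dots> = e j" using zx x(4) by simp
  finally show ?thesis ..
qed

text \<open>A nonzero residue makes the passage from \<open>e i\<close> through \<open>e j\<close>
  and back left invertible, which yields \<open>p \<otimes> q = e i\<close>. Then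
  \<open>q \<otimes> p\<close> is an idempotent in the corner at \<open>e j\<close>, so it is
  \<open>\<zero>\<close> or \<open>e j\<close>; the value \<open>\<zero>\<close> would force
  \<open>e i = \<zero>\<close>, although \<open>e i\<close> has residue 1.\<close>

lemma psi_nonzero_imp_equivalent:
  assumes i: "i < n" and j: "j < n" and x: "x \<in> carrier A" and y: "y \<in> carrier A"
    and "\<psi> i (x \<otimes> e j \<otimes> y) \<noteq> \<zero>\<^bsub>K\<^esub>"
  shows "equivalent_idempotents i j"
proof -
  obtain w where w: "w \<in> carrier A" "w \<otimes> e i \<otimes> (x \<otimes> e j \<otimes> y) \<otimes> e i = e i"
    using psi_unit[OF i _ assms(5)] i j x y by auto
  \<comment> \<open>The left inverse \<open>w\<close> is absorbed into \<open>p\<close>; the outer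
    idempotents place \<open>p\<close> and \<open>q\<close> in the two off-diagonal corners between
    \<open>e i\<close> and \<open>e j\<close>.\<close>
  define p where "p = e i \<otimes> w \<otimes> e i \<otimes> x \<otimes> e j"
  define q where "q = e j \<otimes> y \<otimes> e i"
  have c: "p \<in> carrier A" "q \<in> carrier A" using w(1) x y i j by (auto simp: p_def q_def)
  have pq: "p \<otimes> q = e i"
  proof -
    have "p \<otimes> q = e i \<otimes> w \<otimes> e i \<otimes> x \<otimes> (e j \<otimes> e j) \<otimes> y \<otimes> e i"
      using w(1) x y i j unfolding p_def q_def by (simp add: E.A.m_assoc)
    also have "\<dots> = e i \<otimes> (w \<otimes> e i \<otimes> (x \<otimes> e j \<otimes> y) \<otimes> e i)"
      unfolding e_idem[OF j] using w(1) x y i j by (simp add: E.A.m_assoc)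
    finally show ?thesis using i by (simp add: w(2) e_idem)
  qed
  have p: "e i \<otimes> p = p" "p \<otimes> e j = p"
  proof -
    have "e i \<otimes> p = (e i \<otimes> e i) \<otimes> w \<otimes> e i \<otimes> x \<otimes> e j"
      using w(1) x i j unfolding p_def by (simp only: E.A.m_assoc e_closed E.A.m_closed)
    then show "e i \<otimes> p = p" by (simp add: p_def e_idem i)
    show "p \<otimes> e j = p" using w(1) x i j unfolding p_def by (simp add: E.A.m_assoc e_idem)
  qed
  have q: "e j \<otimes> q = q" "q \<otimes> e i = q"
  proof -
    have "e j \<otimes> q = (e j \<otimes> e j) \<otimes> y \<otimes> e i"
      using y i j unfolding q_def by (simp only: E.A.m_assoc e_closed E.A.m_closed)
    then show "e j \<otimes> q = q" by (simp add: q_def e_idem j)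
    show "q \<otimes> e i = q" using y i j unfolding q_def by (simp add: E.A.m_assoc e_idem)
  qed
  have qpqp: "q \<otimes> p \<otimes> (q \<otimes> p) = q \<otimes> p"
  proof -
    have "q \<otimes> p \<otimes> (q \<otimes> p) = q \<otimes> (p \<otimes> q) \<otimes> p" using c by (simp add: E.A.m_assoc)
    then show ?thesis by (simp add: pq q)
  qed
  have "e j \<otimes> (q \<otimes> p) = q \<otimes> p"
    using E.A.m_assoc[of "e j" q p] c j by (simp add: q)
  moreover have "q \<otimes> p \<otimes> e j = q \<otimes> p" using c j by (simp add: E.A.m_assoc p)
  ultimately have "q \<otimes> p = \<zero> \<or> q \<otimes> p = e j"
    using corner_idempotent_trivial[OF j _ _ _ qpqp] c by simp
  moreover have "q \<otimes> p \<noteq> \<zero>"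
  proof
    assume "q \<otimes> p = \<zero>"
    then have "p \<otimes> (q \<otimes> p) \<otimes> q = \<zero>" using c by simp
    moreover have "p \<otimes> (q \<otimes> p) \<otimes> q = (p \<otimes> q) \<otimes> (p \<otimes> q)" using c by (simp add: E.A.m_assoc)
    ultimately have "e i = \<zero>" using i by (simp add: pq e_idem)
    then show False using psi_e[OF i] psi_zero[OF i] by simp
  qed
  ultimately show ?thesis unfolding equivalent_idempotents_def using c p q pq by blast
qed

end

text \<open>\<open>\<rho> j\<close> is the chosen representative of the class of \<open>j\<close>,
  \<open>u j\<close> an isomorphism from the summand \<open>j\<close> onto it, and
  \<open>v j\<close> its inverse. Residues are taken at representatives only.\<close>

locale matrix_frame = local_idempotents A K n e \<psi>
  for A :: "('b, 'e, 'x) module_scheme" (structure) and K :: "('b, 'k) ring_scheme" (structure)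
    and n e \<psi> +
  fixes \<rho> :: "nat \<Rightarrow> nat" and u v :: "nat \<Rightarrow> 'e"
  assumes rho_less [simp]: "j < n \<Longrightarrow> \<rho> j < n"
    and u_closed [simp]: "j < n \<Longrightarrow> u j \<in> carrier A"
    and v_closed [simp]: "j < n \<Longrightarrow> v j \<in> carrier A"
    and u_e: "j < n \<Longrightarrow> u j \<otimes> e j = u j"
    and e_v: "j < n \<Longrightarrow> e j \<otimes> v j = v j"
    and u_v: "j < n \<Longrightarrow> u j \<otimes> v j = e (\<rho> j)"
    and v_u: "j < n \<Longrightarrow> v j \<otimes> u j = e j"
    and psi_other: "\<lbrakk>a < n; b < n; \<rho> b \<noteq> \<rho> a; x \<in> carrier A; y \<in> carrier A\<rbrakk>
        \<Longrightarrow> \<psi> (\<rho> a) (x \<otimes> e b \<otimes> y) = \<zero>\<^bsub>K\<^esub>"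
begin

text \<open>The component of \<open>f\<close> from summand \<open>b\<close> to summand
  \<open>a\<close>, turned by \<open>v b\<close> and \<open>u a\<close> into an endomorphism of the
  common representative when \<open>\<rho> a = \<rho> b\<close>.\<close>

definition entry :: "nat \<Rightarrow> nat \<Rightarrow> 'e \<Rightarrow> 'b" where
  "entry a b f = \<psi> (\<rho> a) (u a \<otimes> f \<otimes> v b)"

definition entry_kernel :: "'e set" where
  "entry_kernel = {f \<in> carrier A. \<forall>a<n. \<forall>b<n. \<rho> a = \<rho> b \<longrightarrow> entry a b f = \<zero>\<^bsub>K\<^esub>}"

lemma sum_e_right: "x \<in> carrier A \<Longrightarrow> (\<Oplus>j\<in>{..<n}. x \<otimes> e j) = x"
  using E.A.finsum_rdistr[of "{..<n}" x e] by (simp add: e_sum Pi_def)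

lemma e_u: "j < n \<Longrightarrow> e (\<rho> j) \<otimes> u j = u j"
  using E.A.m_assoc[of "u j" "v j" "u j"] by (simp add: u_v v_u u_e)

lemma v_e: "j < n \<Longrightarrow> v j \<otimes> e (\<rho> j) = v j"
  using E.A.m_assoc[of "v j" "u j" "v j"] by (simp add: u_v v_u e_v)

lemma u_v_if: "\<lbrakk>i < n; j < n\<rbrakk> \<Longrightarrow> u i \<otimes> v j = (if i = j then e (\<rho> i) else \<zero>)"
proof -
  assume ij: "i < n" "j < n"
  have "u i \<otimes> v j = (u i \<otimes> e i) \<otimes> (e j \<otimes> v j)" using ij by (simp add: u_e e_v)
  also have "\<dots> = u i \<otimes> (e i \<otimes> e j) \<otimes> v j" using ij by (simp add: E.A.m_assoc)
  finally show ?thesis using ij by (auto simp: u_v e_orth)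
qed

section \<open>Entries as matrix coefficients\<close>

lemma entry_closed [simp]: "\<lbrakk>a < n; b < n; f \<in> carrier A\<rbrakk> \<Longrightarrow> entry a b f \<in> carrier K"
  by (simp add: entry_def)

lemma entry_add: "\<lbrakk>a < n; b < n; f \<in> carrier A; g \<in> carrier A\<rbrakk>
    \<Longrightarrow> entry a b (f \<oplus> g) = entry a b f \<oplus>\<^bsub>K\<^esub> entry a b g"
  by (simp add: entry_def E.A.r_distr E.A.l_distr psi_add)

lemma entry_smult: "\<lbrakk>a < n; b < n; c \<in> carrier K; f \<in> carrier A\<rbrakk>
    \<Longrightarrow> entry a b (c \<odot> f) = c \<otimes>\<^bsub>K\<^esub> entry a b f"
  by (simp add: entry_def E.smult_mult_left E.smult_mult_right psi_smult)

lemma entry_zero [simp]: "\<lbrakk>a < n; b < n\<rbrakk> \<Longrightarrow> entry a b \<zero> = \<zero>\<^bsub>K\<^esub>"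
  using entry_smult[of a b "\<zero>\<^bsub>K\<^esub>" \<zero>] by simp

lemma entry_minus: "\<lbrakk>a < n; b < n; f \<in> carrier A\<rbrakk> \<Longrightarrow> entry a b (\<ominus> f) = \<ominus>\<^bsub>K\<^esub> entry a b f"
  using entry_smult[of a b "\<ominus>\<^bsub>K\<^esub> \<one>\<^bsub>K\<^esub>" f]
  by (simp add: E.smult_l_minus F.l_minus)

lemma entry_diff: "\<lbrakk>a < n; b < n; f \<in> carrier A; g \<in> carrier A\<rbrakk>
    \<Longrightarrow> entry a b (f \<ominus> g) = entry a b f \<ominus>\<^bsub>K\<^esub> entry a b g"
  by (simp add: a_minus_def entry_add entry_minus)

lemma psi_finsum:
  assumes "j < n" and "finite S" and "x \<in> S \<rightarrow> carrier A"
  shows "\<psi> j (\<Oplus>s\<in>S. x s) = (\<Oplus>\<^bsub>K\<^esub>s\<in>S. \<psi> j (x s))"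
  using assms(2,3)
proof (induction S)
  case empty
  then show ?case using assms(1) by simp
next
  case (insert s S)
  then have "x s \<in> carrier A" "x \<in> S \<rightarrow> carrier A" by auto
  moreover from this have "(\<lambda>s. \<psi> j (x s)) \<in> S \<rightarrow> carrier K" using assms(1) by (auto simp: Pi_def)
  ultimately show ?case using insert assms(1) by (simp add: psi_add)
qed

lemma entry_finsum:
  assumes "a < n" "b < n" and "finite S" and "x \<in> S \<rightarrow> carrier A"
  shows "entry a b (\<Oplus>s\<in>S. x s) = (\<Oplus>\<^bsub>K\<^esub>s\<in>S. entry a b (x s))"
proof -
  have "u a \<otimes> (\<Oplus>s\<in>S. x s) \<otimes> v b = (\<Oplus>s\<in>S. u a \<otimes> x s \<otimes> v b)"
    using assms by (simp add: E.A.finsum_rdistr E.A.finsum_ldistr Pi_def)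
  then show ?thesis unfolding entry_def using assms
    by (simp add: psi_finsum Pi_def)
qed

text \<open>Insert \<open>\<one> = (\<Oplus>t. e t)\<close> between \<open>f\<close> and
  \<open>g\<close>. Terms with \<open>t\<close> in another class vanish by \<open>psi_other\<close>;
  for \<open>t\<close> in the same class,
  \<open>e t = v t \<otimes> e (\<rho> a) \<otimes> u t\<close> splits the term at the
  representative, where \<open>psi_mult\<close> applies.\<close>

lemma entry_mult:
  assumes ab: "a < n" "b < n" "\<rho> a = \<rho> b" and f: "f \<in> carrier A" and g: "g \<in> carrier A"
  shows "entry a b (f \<otimes> g) = (\<Oplus>\<^bsub>K\<^esub>t\<in>{t. t < n \<and> \<rho> t = \<rho> a}. entry a t f \<otimes>\<^bsub>K\<^esub> entry t b g)"
proof -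
  have "entry a b (f \<otimes> g) = \<psi> (\<rho> a) (u a \<otimes> (\<Oplus>t\<in>{..<n}. f \<otimes> e t) \<otimes> g \<otimes> v b)"
    using ab f g by (simp add: entry_def sum_e_right E.A.m_assoc)
  also have "u a \<otimes> (\<Oplus>t\<in>{..<n}. f \<otimes> e t) \<otimes> g \<otimes> v b = (\<Oplus>t\<in>{..<n}. u a \<otimes> f \<otimes> e t \<otimes> (g \<otimes> v b))"
  proof -
    have "u a \<otimes> (\<Oplus>t\<in>{..<n}. f \<otimes> e t) \<otimes> g \<otimes> v b = (\<Oplus>t\<in>{..<n}. u a \<otimes> (f \<otimes> e t) \<otimes> g \<otimes> v b)"
      using ab f g by (simp add: E.A.finsum_rdistr E.A.finsum_ldistr Pi_def)
    also have "\<dots> = (\<Oplus>t\<in>{..<n}. u a \<otimes> f \<otimes> e t \<otimes> (g \<otimes> v b))"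
      using ab f g by (intro E.M.add.finprod_cong') (auto simp: E.A.m_assoc)
    finally show ?thesis .
  qed
  also have "\<psi> (\<rho> a) \<dots> = (\<Oplus>\<^bsub>K\<^esub>t\<in>{..<n}. \<psi> (\<rho> a) (u a \<otimes> f \<otimes> e t \<otimes> (g \<otimes> v b)))"
    using ab f g by (intro psi_finsum) auto
  also have "\<dots> = (\<Oplus>\<^bsub>K\<^esub>t\<in>{t. t < n \<and> \<rho> t = \<rho> a}. entry a t f \<otimes>\<^bsub>K\<^esub> entry t b g)"
  proof (rule F.add.finprod_mono_neutral_cong_right)
    fix t assume t: "t \<in> {t. t < n \<and> \<rho> t = \<rho> a}"
    then have "e t = v t \<otimes> e (\<rho> a) \<otimes> u t" using v_u[of t] v_e[of t] by auto
    then have "u a \<otimes> f \<otimes> e t \<otimes> (g \<otimes> v b) = (u a \<otimes> f \<otimes> v t) \<otimes> e (\<rho> a) \<otimes> (u t \<otimes> g \<otimes> v b)"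
      using t ab f g by (simp add: E.A.m_assoc)
    then show "\<psi> (\<rho> a) (u a \<otimes> f \<otimes> e t \<otimes> (g \<otimes> v b)) = entry a t f \<otimes>\<^bsub>K\<^esub> entry t b g"
      using t ab f g by (simp add: psi_mult entry_def)
  qed (use ab f g psi_other[OF ab(1), of _ "u a \<otimes> f" "g \<otimes> v b"] in auto)
  finally show ?thesis .
qed

lemma entry_one: "\<lbrakk>a < n; b < n; \<rho> a = \<rho> b\<rbrakk> \<Longrightarrow> entry a b \<one> = (if a = b then \<one>\<^bsub>K\<^esub> else \<zero>\<^bsub>K\<^esub>)"
  using entry_zero[of a b] by (auto simp: entry_def u_v_if psi_e)

text \<open>\<open>v a \<otimes> u b\<close> passes from summand \<open>b\<close> to summand
  \<open>a\<close> through their representative and plays the role of the matrix unit at place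
  \<open>(a, b)\<close>.\<close>

lemma entry_matrix_unit:
  assumes "i < n" "j < n" "\<rho> i = \<rho> j" "a < n" "b < n" "\<rho> a = \<rho> b" "c \<in> carrier K"
  shows "entry i j (c \<odot> (v a \<otimes> u b)) = (if i = a \<and> j = b then c else \<zero>\<^bsub>K\<^esub>)"
proof -
  have "u i \<otimes> (v a \<otimes> u b) \<otimes> v j = (u i \<otimes> v a) \<otimes> (u b \<otimes> v j)"
    using assms by (simp add: E.A.m_assoc)
  then show ?thesis
    using assms by (auto simp: entry_smult) (auto simp: entry_def u_v_if e_idem psi_e)
qed

text \<open>Matrix units are available at every place \<open>(a, b)\<close> with
  \<open>\<rho> a = \<rho> b\<close>, so a prescribed family of scalars is realised by the
  corresponding linear combination.\<close>

lemma entry_surj: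
  assumes "\<And>a b. \<lbrakk>a < n; b < n; \<rho> a = \<rho> b\<rbrakk> \<Longrightarrow> c a b \<in> carrier K"
  shows "\<exists>f\<in>carrier A. \<forall>a<n. \<forall>b<n. \<rho> a = \<rho> b \<longrightarrow> entry a b f = c a b"
proof (intro bexI allI impI)
  define S where "S = {p \<in> {..<n} \<times> {..<n}. \<rho> (fst p) = \<rho> (snd p)}"
  define x where "x p = c (fst p) (snd p) \<odot> (v (fst p) \<otimes> u (snd p))" for p
  have S: "finite S" by (simp add: S_def)
  have x: "x \<in> S \<rightarrow> carrier A" using assms by (auto simp: S_def x_def)
  then show "(\<Oplus>p\<in>S. x p) \<in> carrier A" by simp
  fix a b assume ab: "a < n" "b < n" "\<rho> a = \<rho> b"
  have "entry a b (\<Oplus>p\<in>S. x p) = (\<Oplus>\<^bsub>K\<^esub>p\<in>S. entry a b (x p))"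
    using entry_finsum[OF ab(1,2) S x] .
  also have "\<dots> = (\<Oplus>\<^bsub>K\<^esub>p\<in>S. if (a, b) = p then c a b else \<zero>\<^bsub>K\<^esub>)"
  proof (rule F.add.finprod_cong')
    fix p assume "p \<in> S"
    then show "entry a b (x p) = (if (a, b) = p then c a b else \<zero>\<^bsub>K\<^esub>)"
      using ab assms by (auto simp: S_def x_def entry_matrix_unit split: if_splits)
  qed (use ab assms in auto)
  also have "\<dots> = c a b"
    using F.add.finprod_singleton[of "(a, b)" S "\<lambda>p. c a b"] ab assms S
    by (simp add: S_def)
  finally show "entry a b (\<Oplus>p\<in>S. x p) = c a b" .
qed

lemma entry_finsum_zero:
  assumes "\<And>t. t \<in> T \<Longrightarrow> x t = \<zero>\<^bsub>K\<^esub>"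
  shows "(\<Oplus>\<^bsub>K\<^esub>t\<in>T. x t) = \<zero>\<^bsub>K\<^esub>"
  using F.add.finprod_one_eqI[of T x] assms by simp

text \<open>The quotient by this left ideal is the space of columns of one block, a simple module
  over the block matrices. Column \<open>b\<close> of a product depends only on column
  \<open>b\<close> of the right factor, which gives the left ideal property.\<close>

lemma maximal_left_ideal_column:
  assumes b: "b < n"
  shows "maximal_left_ideal {f \<in> carrier A. \<forall>a<n. \<rho> a = \<rho> b \<longrightarrow> entry a b f = \<zero>\<^bsub>K\<^esub>} A"
    (is "maximal_left_ideal ?L A")
proof (rule E.A.maximal_left_idealI)
  show "left_ideal ?L A"
  proof (rule E.A.left_idealI)
    fix r f assume "r \<in> carrier A" "f \<in> ?L"
    then show "r \<otimes> f \<in> ?L" using b by (auto simp: entry_mult intro!: entry_finsum_zero)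
  qed (use b in \<open>auto simp: entry_add\<close>)
  show "\<one> \<notin> ?L" using b by (auto simp: entry_one)
  fix f assume f: "f \<in> carrier A" "f \<notin> ?L"
  then obtain a where a: "a < n" "\<rho> a = \<rho> b" "entry a b f \<noteq> \<zero>\<^bsub>K\<^esub>" by auto
  \<comment> \<open>With \<open>c\<close> times the matrix unit at \<open>(b, a)\<close> as left
    factor, the nonzero entry in row \<open>a\<close> of column \<open>b\<close> is moved to place
    \<open>(b, b)\<close> and scaled to 1. Column \<open>b\<close> of the product then equals column
    \<open>b\<close> of \<open>\<one>\<close>.\<close>
  define c where "c = inv\<^bsub>K\<^esub> entry a b f"
  have "entry a b f \<in> Units K" using a b f F.field_Units by auto
  then have c: "c \<in> carrier K" "c \<otimes>\<^bsub>K\<^esub> entry a b f = \<one>\<^bsub>K\<^esub>"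
    by (auto simp: c_def)
  have "entry i b (\<one> \<ominus> (c \<odot> (v b \<otimes> u a)) \<otimes> f) = \<zero>\<^bsub>K\<^esub>" if i: "i < n" "\<rho> i = \<rho> b" for i
  proof -
    have "u i \<otimes> ((v b \<otimes> u a) \<otimes> f) \<otimes> v b = (u i \<otimes> v b) \<otimes> (u a \<otimes> f \<otimes> v b)"
      using i a b f by (simp add: E.A.m_assoc)
    also have "\<dots> = (if i = b then u a \<otimes> f \<otimes> v b else \<zero>)"
      using i a b f e_u[of a] by (simp add: u_v_if E.A.m_assoc[symmetric])
    finally have *: "u i \<otimes> ((v b \<otimes> u a) \<otimes> f) \<otimes> v b = (if i = b then u a \<otimes> f \<otimes> v b else \<zero>)" .
    have "entry i b ((v b \<otimes> u a) \<otimes> f) = (if i = b then entry a b f else \<zero>\<^bsub>K\<^esub>)"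
      using * i a rho_less[OF i(1)] by (simp add: entry_def)
    then show ?thesis
      using a b c f i by (simp add: a_minus_def entry_add entry_minus E.smult_mult_left entry_smult entry_one F.r_neg)
  qed
  then show "\<exists>r\<in>carrier A. \<one> \<ominus> r \<otimes> f \<in> ?L"
    using a b c f by (intro bexI[of _ "c \<odot> (v b \<otimes> u a)"]) auto
qed

lemma entry_kernel_closed [simp]: "x \<in> entry_kernel \<Longrightarrow> x \<in> carrier A"
  by (simp add: entry_kernel_def)

lemma entry_kernelD: "\<lbrakk>x \<in> entry_kernel; a < n; b < n; \<rho> a = \<rho> b\<rbrakk> \<Longrightarrow> entry a b x = \<zero>\<^bsub>K\<^esub>"
  unfolding entry_kernel_def by blast

lemma entry_kernelI:
  "\<lbrakk>x \<in> carrier A; \<And>a b. \<lbrakk>a < n; b < n; \<rho> a = \<rho> b\<rbrakk> \<Longrightarrow> entry a b x = \<zero>\<^bsub>K\<^esub>\<rbrakk> \<Longrightarrow> x \<in> entry_kernel"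
  unfolding entry_kernel_def by blast

lemma entry_kernel_diff: "\<lbrakk>x \<in> entry_kernel; y \<in> entry_kernel\<rbrakk> \<Longrightarrow> x \<ominus> y \<in> entry_kernel"
  by (rule entry_kernelI) (simp_all add: entry_diff entry_kernelD F.r_neg a_minus_def[of K])

lemma entry_kernel_mult_left:
  assumes "r \<in> carrier A" and "x \<in> entry_kernel"
  shows "r \<otimes> x \<in> entry_kernel"
proof (rule entry_kernelI)
  fix a b assume ab: "a < n" "b < n" "\<rho> a = \<rho> b"
  then show "entry a b (r \<otimes> x) = \<zero>\<^bsub>K\<^esub>"
    unfolding entry_mult[OF ab assms(1) entry_kernel_closed[OF assms(2)]]
    using assms by (intro entry_finsum_zero) (simp add: entry_kernelD)
qed (use assms in simp)

lemma entry_kernel_mult_right: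
  assumes "r \<in> carrier A" and "x \<in> entry_kernel"
  shows "x \<otimes> r \<in> entry_kernel"
proof (rule entry_kernelI)
  fix a b assume ab: "a < n" "b < n" "\<rho> a = \<rho> b"
  then show "entry a b (x \<otimes> r) = \<zero>\<^bsub>K\<^esub>"
    unfolding entry_mult[OF ab entry_kernel_closed[OF assms(2)] assms(1)]
    using assms by (intro entry_finsum_zero) (simp add: entry_kernelD)
qed (use assms in simp)

section \<open>The radical as the common kernel of the entries\<close>

lemma Rad_subset_entry_kernel: "Rad A \<subseteq> entry_kernel"
proof
  fix f assume f: "f \<in> Rad A"
  have "entry a b f = \<zero>\<^bsub>K\<^esub>" if "a < n" "b < n" "\<rho> a = \<rho> b" for a b
    using f maximal_left_ideal_column[OF that(2)] that unfolding Rad_def by blast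
  then show "f \<in> entry_kernel" using f by (intro entry_kernelI) (auto simp: Rad_def)
qed

text \<open>The diagonal entry of \<open>\<one> \<ominus> z\<close> at \<open>m\<close> is 1, so
  \<open>psi_unit\<close> supplies a left inverse at the representative of \<open>m\<close>;
  conjugation by \<open>v m\<close> and \<open>u m\<close> brings it back to the summand
  \<open>m\<close>. This is the pivot of the elimination.\<close>

lemma diagonal_left_inverse:
  assumes z: "z \<in> entry_kernel" and m: "m < n"
  obtains w where "w \<in> carrier A" "w \<otimes> e m = w" "w \<otimes> (\<one> \<ominus> z) \<otimes> e m = e m"
proof -
  define y where "y = \<one> \<ominus> z"
  have yc: "y \<in> carrier A" using z by (simp add: y_def)
  have "entry m m y \<noteq> \<zero>\<^bsub>K\<^esub>"
    using entry_kernelD[OF z, of m m] z m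
    by (simp add: y_def a_minus_def entry_add entry_minus entry_one)
  then obtain w where w: "w \<in> carrier A"
      "w \<otimes> e (\<rho> m) \<otimes> (u m \<otimes> y \<otimes> v m) \<otimes> e (\<rho> m) = e (\<rho> m)"
    using psi_unit[of "\<rho> m" "u m \<otimes> y \<otimes> v m"] m yc by (auto simp: entry_def)
  let ?w = "v m \<otimes> w \<otimes> u m"
  have "?w \<otimes> y \<otimes> e m = v m \<otimes> (w \<otimes> (e (\<rho> m) \<otimes> u m) \<otimes> y \<otimes> (v m \<otimes> e (\<rho> m))) \<otimes> u m"
    using m yc w(1) by (simp add: e_u v_e E.A.m_assoc v_u)
  also have "\<dots> = v m \<otimes> (w \<otimes> e (\<rho> m) \<otimes> (u m \<otimes> y \<otimes> v m) \<otimes> e (\<rho> m)) \<otimes> u m"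
    using m yc w(1) by (simp add: E.A.m_assoc)
  also have "\<dots> = e m" using m by (simp add: w(2) v_e v_u)
  finally have "?w \<otimes> y \<otimes> e m = e m" .
  moreover have "?w \<otimes> e m = ?w" using m w(1) by (simp add: E.A.m_assoc u_e)
  moreover have "?w \<in> carrier A" using m w(1) by simp
  ultimately show ?thesis using that by (simp add: y_def)
qed

text \<open>Column elimination: left multiplication clears the columns of \<open>z\<close> one after the other.\<close>

lemma left_inverse_one_minus_kernel:
  assumes x: "x \<in> entry_kernel"
  shows "\<exists>s\<in>carrier A. s \<otimes> (\<one> \<ominus> x) = \<one>"
proof -
  \<comment> \<open>The invariant keeps \<open>z\<close> inside \<open>entry_kernel\<close>, which
    guarantees an invertible pivot in every later column.\<close>
  have "\<exists>s\<in>carrier A. \<exists>z\<in>entry_kernel. s \<otimes> (\<one> \<ominus> x) = \<one> \<ominus> z \<and> (\<forall>b<m. z \<otimes> e b = \<zero>)"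
    if "m \<le> n" for m
    using that
  proof (induction m)
    case 0
    then show ?case using x by (intro bexI[of _ \<one>] bexI[of _ x]) auto
  next
    case (Suc m)
    then obtain s z where s: "s \<in> carrier A" and z: "z \<in> entry_kernel"
      and sx: "s \<otimes> (\<one> \<ominus> x) = \<one> \<ominus> z" and zb: "\<And>b. b < m \<Longrightarrow> z \<otimes> e b = \<zero>" by auto
    obtain w where w: "w \<in> carrier A" "w \<otimes> e m = w" "w \<otimes> (\<one> \<ominus> z) \<otimes> e m = e m"
      using diagonal_left_inverse[OF z, of m] Suc.prems by auto
    \<comment> \<open>Chosen so that \<open>(\<one> \<oplus> z \<otimes> e m \<otimes> w) \<otimes>
      (\<one> \<ominus> z) = \<one> \<ominus> z'\<close>. Column \<open>m\<close> of
      \<open>z'\<close> vanishes because \<open>w\<close> inverts the pivot. An earlier column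
      \<open>b\<close> stays zero because there
      \<open>(\<one> \<ominus> z) \<otimes> e b = e b\<close>, and
      \<open>w = w \<otimes> e m\<close> kills \<open>e b\<close>.\<close>
    define z' where "z' = z \<ominus> z \<otimes> e m \<otimes> w \<otimes> (\<one> \<ominus> z)"
    have m: "m < n" using Suc.prems by simp
    have zc: "z \<in> carrier A" "\<one> \<ominus> z \<in> carrier A" using z by auto
    have z': "z' \<in> entry_kernel"
      unfolding z'_def using z w(1) m zc
      by (intro entry_kernel_diff entry_kernel_mult_right) auto
    have "(\<one> \<oplus> z \<otimes> e m \<otimes> w) \<otimes> s \<otimes> (\<one> \<ominus> x) = (\<one> \<oplus> z \<otimes> e m \<otimes> w) \<otimes> (\<one> \<ominus> z)"
      using s x zc w(1) m by (simp add: E.A.m_assoc sx)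
    also have "\<dots> = \<one> \<ominus> z \<oplus> z \<otimes> e m \<otimes> w \<otimes> (\<one> \<ominus> z)"
      using zc w(1) m by (simp add: E.A.l_distr)
    also have "\<dots> = \<one> \<ominus> z'"
    proof -
      have "z \<otimes> e m \<otimes> w \<otimes> (\<one> \<ominus> z) \<in> carrier A" using zc w(1) m by simp
      then show ?thesis unfolding z'_def
        using zc(1) by (simp add: a_minus_def E.M.minus_add E.M.a_assoc)
    qed
    finally have 1: "(\<one> \<oplus> z \<otimes> e m \<otimes> w) \<otimes> s \<otimes> (\<one> \<ominus> x) = \<one> \<ominus> z'" .
    have "z' \<otimes> e b = \<zero>" if b: "b < Suc m" for b
    proof -
      have bn: "b < n" using b m by simp
      have "z' \<otimes> e b = z \<otimes> e b \<ominus> z \<otimes> e m \<otimes> (w \<otimes> (\<one> \<ominus> z) \<otimes> e b)"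
        unfolding z'_def using zc w(1) m bn
        by (simp add: a_minus_def E.A.l_distr E.A.l_minus E.A.m_assoc)
      also have "\<dots> = \<zero>"
      proof (cases "b = m")
        case True
        then show ?thesis using w(3) zc m by (simp add: E.A.m_assoc e_idem E.M.r_neg a_minus_def)
      next
        case False
        then have zb': "z \<otimes> e b = \<zero>" using b zb by simp
        have "w \<otimes> (\<one> \<ominus> z) \<otimes> e b = w \<otimes> (e b \<ominus> z \<otimes> e b)"
          using w(1) zc bn by (simp add: a_minus_def E.A.m_assoc E.A.l_distr E.A.l_minus)
        also have "\<dots> = w \<otimes> e m \<otimes> e b" using w bn by (simp add: zb' a_minus_def)
        also have "\<dots> = \<zero>" using w(1) m bn False e_orth[of m b] by (simp add: E.A.m_assoc)
        finally show ?thesis using zb' zc m by (simp add: a_minus_def)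
      qed
      finally show ?thesis .
    qed
    moreover have "(\<one> \<oplus> z \<otimes> e m \<otimes> w) \<otimes> s \<in> carrier A" using zc w(1) m s by simp
    ultimately show ?case using 1 z' by blast
  qed
  then obtain s z where s: "s \<in> carrier A" and z: "z \<in> entry_kernel"
    and sx: "s \<otimes> (\<one> \<ominus> x) = \<one> \<ominus> z" and zb: "\<And>b. b < n \<Longrightarrow> z \<otimes> e b = \<zero>" by blast
  \<comment> \<open>All columns of \<open>z\<close> are cleared and the \<open>e b\<close> sum to
    \<open>\<one>\<close>, so \<open>z\<close> itself is zero and \<open>s\<close> is the left
    inverse.\<close>
  have "z = (\<Oplus>b\<in>{..<n}. z \<otimes> e b)" using z by (simp add: sum_e_right)
  also have "\<dots> = \<zero>" using zb E.M.add.finprod_one_eqI[of "{..<n}" "\<lambda>b. z \<otimes> e b"] by simp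
  finally show ?thesis using s sx by (auto simp: a_minus_def)
qed

text \<open>Since \<open>entry_kernel\<close> absorbs left factors, left inverses of
  \<open>\<one> \<ominus> x\<close> for all its members are exactly what \<open>mem_RadI\<close>
  asks for.\<close>

lemma Rad_eq_entry_kernel: "Rad A = entry_kernel"
proof
  show "entry_kernel \<subseteq> Rad A"
    using E.A.mem_RadI left_inverse_one_minus_kernel entry_kernel_mult_left entry_kernel_closed
    by blast
qed (rule Rad_subset_entry_kernel)

end

section \<open>Residue characters and quotients by ideals\<close>

text \<open>Scalar multiplication on the quotient is a union over all representatives. For
  \<open>r\<close> in \<open>I\<close> the multiple of \<open>r\<close> by \<open>c\<close> equals
  \<open>(c 1) r\<close> and stays in \<open>I\<close>, so all cosets in the union coincide.\<close>

lemma (in unital_algebra) coset_smult: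
  assumes "ideal I A" and c: "c \<in> carrier K" and x: "x \<in> carrier A"
  shows "(\<Union>y\<in>I +>\<^bsub>A\<^esub> x. I +>\<^bsub>A\<^esub> (c \<odot>\<^bsub>A\<^esub> y)) = I +>\<^bsub>A\<^esub> (c \<odot>\<^bsub>A\<^esub> x)"
proof -
  interpret I: ideal I A by fact
  have "I +>\<^bsub>A\<^esub> (c \<odot>\<^bsub>A\<^esub> y) = I +>\<^bsub>A\<^esub> (c \<odot>\<^bsub>A\<^esub> x)" if y: "y \<in> I +>\<^bsub>A\<^esub> x" for y
  proof -
    obtain r where r: "r \<in> I" "y = r \<oplus>\<^bsub>A\<^esub> x"
      using y by (auto simp: a_r_coset_def')
    have "c \<odot>\<^bsub>A\<^esub> r = (c \<odot>\<^bsub>A\<^esub> \<one>\<^bsub>A\<^esub>) \<otimes>\<^bsub>A\<^esub> r"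
      using c r(1) I.a_Hcarr by (simp add: smult_mult_left)
    then have "c \<odot>\<^bsub>A\<^esub> r \<in> I" using c r(1) I.I_l_closed by simp
    then have cy: "c \<odot>\<^bsub>A\<^esub> y \<in> I +>\<^bsub>A\<^esub> (c \<odot>\<^bsub>A\<^esub> x)"
      using r c x I.a_Hcarr by (auto simp: a_r_coset_def' smult_r_distr)
    show ?thesis
      using I.a_repr_independence'[OF cy] c x by simp
  qed
  moreover have "x \<in> I +>\<^bsub>A\<^esub> x" using I.a_rcos_self x by blast
  ultimately show ?thesis by blast
qed

text \<open>The condition \<open>E'/Rad E' \<simeq> k\<close> recast as an algebra map on elements
  instead of cosets. The last clause expresses locality: whatever survives in the residue field is
  left invertible.\<close>

definition residue_character ::
    "('b, 'k) ring_scheme \<Rightarrow> ('b, 'e, 'x) module_scheme \<Rightarrow> ('e \<Rightarrow> 'b) \<Rightarrow> bool" where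
  "residue_character K A \<phi> \<longleftrightarrow>
    (\<forall>x\<in>carrier A. \<phi> x \<in> carrier K) \<and>
    (\<forall>x\<in>carrier A. \<forall>y\<in>carrier A. \<phi> (x \<oplus>\<^bsub>A\<^esub> y) = \<phi> x \<oplus>\<^bsub>K\<^esub> \<phi> y) \<and>
    (\<forall>x\<in>carrier A. \<forall>y\<in>carrier A. \<phi> (x \<otimes>\<^bsub>A\<^esub> y) = \<phi> x \<otimes>\<^bsub>K\<^esub> \<phi> y) \<and>
    (\<forall>c\<in>carrier K. \<forall>x\<in>carrier A. \<phi> (c \<odot>\<^bsub>A\<^esub> x) = c \<otimes>\<^bsub>K\<^esub> \<phi> x) \<and>
    \<phi> \<one>\<^bsub>A\<^esub> = \<one>\<^bsub>K\<^esub> \<and>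
    (\<forall>x\<in>carrier A. \<phi> x \<noteq> \<zero>\<^bsub>K\<^esub> \<longrightarrow> (\<exists>y\<in>carrier A. y \<otimes>\<^bsub>A\<^esub> x = \<one>\<^bsub>A\<^esub>))"

text \<open>The map is the projection modulo the radical followed by the given isomorphism. If
  \<open>\<phi> x\<close> is nonzero, surjectivity gives \<open>g\<close> with
  \<open>\<phi> g\<close> inverse to \<open>\<phi> x\<close>; injectivity of the isomorphism puts
  \<open>1 - g x\<close> into the radical, and the left inverse lifts.\<close>

lemma (in unital_algebra) residue_character_exists:
  assumes "field K" and iso: "algebra_isomorphic K (quotient_algebra A (Rad A)) (base_algebra K)"
  shows "\<exists>\<phi>. residue_character K A \<phi>"
proof -
  interpret F: field K by fact
  interpret I: ideal "Rad A" A by (rule A.ideal_Rad)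
  let ?Q = "A Quot Rad A"
  obtain h where h: "h \<in> ring_iso (quotient_algebra A (Rad A)) (base_algebra K)"
    and hs: "\<And>a S. \<lbrakk>a \<in> carrier K; S \<in> carrier ?Q\<rbrakk>
      \<Longrightarrow> h (\<Union>x\<in>S. Rad A +>\<^bsub>A\<^esub> (a \<odot>\<^bsub>A\<^esub> x)) = a \<otimes> h S"
    using iso by (auto simp: algebra_isomorphic_def quotient_algebra_def base_algebra_def)
  have hom: "h \<in> ring_hom ?Q K" and bij: "bij_betw h (carrier ?Q) (carrier K)"
    using h by (auto simp: ring_iso_def ring_hom_def quotient_algebra_def base_algebra_def)
  define \<phi> where "\<phi> x = h (Rad A +>\<^bsub>A\<^esub> x)" for x
  have coset: "Rad A +>\<^bsub>A\<^esub> x \<in> carrier ?Q" if "x \<in> carrier A" for x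
    using ring_hom_closed[OF I.rcos_ring_hom that] .
  have phi: "\<phi> \<in> ring_hom A K"
    using ring_hom_trans[OF I.rcos_ring_hom hom] by (simp add: \<phi>_def[abs_def] comp_def)
  then interpret P: ring_hom_ring A K \<phi>
    by (intro ring_hom_ringI2 A.ring_axioms F.is_ring)
  have smult: "\<phi> (c \<odot>\<^bsub>A\<^esub> x) = c \<otimes> \<phi> x" if c: "c \<in> carrier K" and x: "x \<in> carrier A" for c x
    using hs[OF c coset[OF x]] coset_smult[OF I.is_ideal c x] by (simp add: \<phi>_def)
  have unit: "\<exists>y\<in>carrier A. y \<otimes>\<^bsub>A\<^esub> x = \<one>\<^bsub>A\<^esub>" if x: "x \<in> carrier A" "\<phi> x \<noteq> \<zero>" for x
  proof -
    have "\<phi> x \<in> Units K" using x F.field_Units by auto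
    then have c: "inv \<phi> x \<in> carrier K" "inv \<phi> x \<otimes> \<phi> x = \<one>" by auto
    then obtain S where "S \<in> carrier ?Q" "h S = inv \<phi> x"
      using bij by (metis bij_betw_def imageE)
    moreover obtain g where g: "g \<in> carrier A" "S = Rad A +>\<^bsub>A\<^esub> g"
      using calculation(1) by (auto simp: FactRing_def A_RCOSETS_def')
    ultimately have "\<phi> g = inv \<phi> x" by (simp add: \<phi>_def)
    then have "\<phi> (\<one>\<^bsub>A\<^esub> \<ominus>\<^bsub>A\<^esub> g \<otimes>\<^bsub>A\<^esub> x) = \<phi> \<zero>\<^bsub>A\<^esub>"
      using g(1) x c by (simp add: a_minus_def[of A] R.r_neg)
    then have "Rad A +>\<^bsub>A\<^esub> (\<one>\<^bsub>A\<^esub> \<ominus>\<^bsub>A\<^esub> g \<otimes>\<^bsub>A\<^esub> x) = Rad A +>\<^bsub>A\<^esub> \<zero>\<^bsub>A\<^esub>"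
      unfolding \<phi>_def using inj_onD[OF bij_betw_imp_inj_on[OF bij]] coset g(1) x(1) by simp
    then have "\<one>\<^bsub>A\<^esub> \<ominus>\<^bsub>A\<^esub> g \<otimes>\<^bsub>A\<^esub> x \<in> Rad A"
      using I.a_rcos_self[of "\<one>\<^bsub>A\<^esub> \<ominus>\<^bsub>A\<^esub> g \<otimes>\<^bsub>A\<^esub> x"] g(1) x(1) I.a_subset
      by simp
    then show ?thesis using A.left_invertible_mod_Rad g(1) x(1) by blast
  qed
  show ?thesis
    unfolding residue_character_def by (rule exI[of _ \<phi>]) (simp add: smult unit)
qed

lemma (in unital_algebra) quotient_algebra_isomorphic:
  assumes hom: "h \<in> ring_hom A D" and surj: "h ` carrier A = carrier D"
    and zero: "h \<zero>\<^bsub>A\<^esub> = \<zero>\<^bsub>D\<^esub>"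
    and smult: "\<And>c x. \<lbrakk>c \<in> carrier K; x \<in> carrier A\<rbrakk> \<Longrightarrow> h (c \<odot>\<^bsub>A\<^esub> x) = c \<odot>\<^bsub>D\<^esub> h x"
  shows "algebra_isomorphic K (quotient_algebra A {x \<in> carrier A. h x = \<zero>\<^bsub>D\<^esub>}) D"
proof -
  \<comment> \<open>The ring axioms of \<open>D\<close> are transported from \<open>A\<close> along
    the surjection. The hypothesis \<open>zero\<close> enters here, as \<open>ring_hom\<close>
    constrains sums, products and the unit.\<close>
  have ring_D: "ring D"
    using A.ring_hom_imp_img_ring[OF hom] by (simp add: surj zero)
  interpret H: ring_hom_ring A D h
    by (rule ring_hom_ringI2[OF A.ring_axioms ring_D hom])
  define I where "I = {x \<in> carrier A. h x = \<zero>\<^bsub>D\<^esub>}"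
  have ker: "a_kernel A D h = I" unfolding I_def by (rule a_kernel_def')
  have idl: "ideal I A" using H.kernel_is_ideal by (simp add: ker)
  define g where "g S = the_elem (h ` S)" for S
  have iso: "g \<in> ring_iso (A Quot I) D"
    using H.FactRing_iso_set[OF surj] by (simp add: ker g_def[abs_def])
  have g: "g (I +>\<^bsub>A\<^esub> x) = h x" if "x \<in> carrier A" for x
    using H.the_elem_simp[OF that] by (simp add: ker g_def)
  have "g (\<Union>y\<in>S. I +>\<^bsub>A\<^esub> (c \<odot>\<^bsub>A\<^esub> y)) = c \<odot>\<^bsub>D\<^esub> g S"
    if c: "c \<in> carrier K" and S: "S \<in> carrier (A Quot I)" for c S
  proof -
    obtain x where x: "x \<in> carrier A" "S = I +>\<^bsub>A\<^esub> x"
      using S by (auto simp: FactRing_def A_RCOSETS_def')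
    then show ?thesis using coset_smult[OF idl c x(1)] c by (simp add: g smult)
  qed
  then show ?thesis
    using iso unfolding I_def[symmetric] algebra_isomorphic_def
    by (intro bexI[of _ g]) (auto simp: quotient_algebra_def ring_iso_def ring_hom_def)
qed

section \<open>Endomorphism algebras\<close>

lemma (in left_module) act_zero [simp]: "u \<in> carrier U \<Longrightarrow> u \<odot>\<^bsub>M\<^esub> \<zero>\<^bsub>M\<^esub> = \<zero>\<^bsub>M\<^esub>"
  using act_r_distr[of u "\<zero>\<^bsub>M\<^esub>" "\<zero>\<^bsub>M\<^esub>"] act_closed[of u "\<zero>\<^bsub>M\<^esub>"]
  by (simp add: M.add.l_cancel_one')

lemma (in left_module) act_minus:
  assumes "u \<in> carrier U" "x \<in> carrier M"
  shows "u \<odot>\<^bsub>M\<^esub> (\<ominus>\<^bsub>M\<^esub> x) = \<ominus>\<^bsub>M\<^esub> (u \<odot>\<^bsub>M\<^esub> x)"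
proof -
  have "u \<odot>\<^bsub>M\<^esub> (\<ominus>\<^bsub>M\<^esub> x) \<oplus>\<^bsub>M\<^esub> u \<odot>\<^bsub>M\<^esub> x = \<zero>\<^bsub>M\<^esub>"
    using assms by (simp add: act_r_distr[symmetric] M.l_neg)
  then show ?thesis using assms by (simp add: M.minus_equality act_closed)
qed

lemma (in left_module) act_finsum:
  assumes "u \<in> carrier U" "finite A" "f \<in> A \<rightarrow> carrier M"
  shows "u \<odot>\<^bsub>M\<^esub> (\<Oplus>\<^bsub>M\<^esub>a\<in>A. f a) = (\<Oplus>\<^bsub>M\<^esub>a\<in>A. u \<odot>\<^bsub>M\<^esub> f a)"
  using assms(2,3)
proof (induction A)
  case (insert a A)
  then have "f a \<in> carrier M" "f \<in> A \<rightarrow> carrier M" by auto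
  moreover from this have "(\<lambda>a. u \<odot>\<^bsub>M\<^esub> f a) \<in> A \<rightarrow> carrier M"
    using assms(1) by (auto simp: Pi_def act_closed)
  ultimately show ?case using insert assms(1) by (simp add: act_r_distr act_closed)
qed (use assms(1) in simp)

locale algebra_module = UA: unital_algebra K U + LM: left_module U M
  for K :: "('b, 'k) ring_scheme" and U :: "('b, 'u, 'x) module_scheme"
    and M :: "('u, 'c, 'y) module_scheme"
begin

abbreviation "E \<equiv> End_algebra U M"

lemma scalar_closed [simp]:
  "\<lbrakk>a \<in> carrier K; x \<in> carrier M\<rbrakk> \<Longrightarrow> scalar_act U M a x \<in> carrier M"
  by (simp add: scalar_act_def LM.act_closed)

lemma scalar_l_distr: "\<lbrakk>a \<in> carrier K; b \<in> carrier K; x \<in> carrier M\<rbrakk>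
    \<Longrightarrow> scalar_act U M (a \<oplus>\<^bsub>K\<^esub> b) x = scalar_act U M a x \<oplus>\<^bsub>M\<^esub> scalar_act U M b x"
  by (simp add: scalar_act_def UA.smult_l_distr LM.act_l_distr)

lemma scalar_r_distr: "\<lbrakk>a \<in> carrier K; x \<in> carrier M; y \<in> carrier M\<rbrakk>
    \<Longrightarrow> scalar_act U M a (x \<oplus>\<^bsub>M\<^esub> y) = scalar_act U M a x \<oplus>\<^bsub>M\<^esub> scalar_act U M a y"
  by (simp add: scalar_act_def LM.act_r_distr)

lemma scalar_assoc: "\<lbrakk>a \<in> carrier K; b \<in> carrier K; x \<in> carrier M\<rbrakk>
    \<Longrightarrow> scalar_act U M (a \<otimes>\<^bsub>K\<^esub> b) x = scalar_act U M a (scalar_act U M b x)"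
  by (simp add: scalar_act_def LM.act_assoc[symmetric] UA.smult_mult_left UA.smult_assoc1)

lemma scalar_one [simp]: "x \<in> carrier M \<Longrightarrow> scalar_act U M \<one>\<^bsub>K\<^esub> x = x"
  by (simp add: scalar_act_def LM.act_one)

text \<open>Scalars act through the elements \<open>a 1\<close> of \<open>U\<close>, which are
  central. This is why a scalar multiple of a \<open>U\<close>-linear map is again
  \<open>U\<close>-linear.\<close>

lemma scalar_act_commute: "\<lbrakk>a \<in> carrier K; w \<in> carrier U; x \<in> carrier M\<rbrakk>
    \<Longrightarrow> w \<odot>\<^bsub>M\<^esub> scalar_act U M a x = scalar_act U M a (w \<odot>\<^bsub>M\<^esub> x)"
  by (simp add: scalar_act_def LM.act_assoc[symmetric] UA.smult_mult_left UA.smult_mult_right)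

lemma hom_scalar: "\<lbrakk>f \<in> module_hom U M N; a \<in> carrier K; x \<in> carrier M\<rbrakk>
    \<Longrightarrow> f (scalar_act U M a x) = scalar_act U N a (f x)"
  by (simp add: scalar_act_def module_hom_smult)

lemma carrier_End: "carrier E = module_hom U M M \<inter> extensional (carrier M)"
  by (simp add: End_algebra_def)

lemma End_memI:
  assumes "\<And>x. x \<in> carrier M \<Longrightarrow> f x \<in> carrier M"
    and "\<And>x y. \<lbrakk>x \<in> carrier M; y \<in> carrier M\<rbrakk> \<Longrightarrow> f (x \<oplus>\<^bsub>M\<^esub> y) = f x \<oplus>\<^bsub>M\<^esub> f y"
    and "\<And>w x. \<lbrakk>w \<in> carrier U; x \<in> carrier M\<rbrakk> \<Longrightarrow> f (w \<odot>\<^bsub>M\<^esub> x) = w \<odot>\<^bsub>M\<^esub> f x"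
  shows "(\<lambda>x\<in>carrier M. f x) \<in> carrier E"
  using assms by (auto simp: carrier_End module_hom_def LM.act_closed)

lemma End_closed [simp]: "\<lbrakk>f \<in> carrier E; x \<in> carrier M\<rbrakk> \<Longrightarrow> f x \<in> carrier M"
  unfolding carrier_End using module_hom_closed[of f U M M] by blast

lemma End_hom_add: "\<lbrakk>f \<in> carrier E; x \<in> carrier M; y \<in> carrier M\<rbrakk>
    \<Longrightarrow> f (x \<oplus>\<^bsub>M\<^esub> y) = f x \<oplus>\<^bsub>M\<^esub> f y"
  unfolding carrier_End using module_hom_add[of f U M M] by blast

lemma End_hom_act: "\<lbrakk>f \<in> carrier E; w \<in> carrier U; x \<in> carrier M\<rbrakk>
    \<Longrightarrow> f (w \<odot>\<^bsub>M\<^esub> x) = w \<odot>\<^bsub>M\<^esub> f x"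
  unfolding carrier_End using module_hom_smult[of f U M M] by blast

lemma End_hom_zero [simp]: "f \<in> carrier E \<Longrightarrow> f \<zero>\<^bsub>M\<^esub> = \<zero>\<^bsub>M\<^esub>"
  using End_hom_add[of f "\<zero>\<^bsub>M\<^esub>" "\<zero>\<^bsub>M\<^esub>"] End_closed[of f "\<zero>\<^bsub>M\<^esub>"]
  by (simp add: LM.M.add.l_cancel_one')

lemma End_eqI: "\<lbrakk>f \<in> carrier E; g \<in> carrier E; \<And>x. x \<in> carrier M \<Longrightarrow> f x = g x\<rbrakk> \<Longrightarrow> f = g"
  unfolding carrier_End using extensionalityI[of f "carrier M" g] by blast

lemma End_apply [simp]:
  assumes "x \<in> carrier M"
  shows "(f \<otimes>\<^bsub>E\<^esub> g) x = f (g x)" "(f \<oplus>\<^bsub>E\<^esub> g) x = f x \<oplus>\<^bsub>M\<^esub> g x" "\<one>\<^bsub>E\<^esub> x = x"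
    "\<zero>\<^bsub>E\<^esub> x = \<zero>\<^bsub>M\<^esub>" "(a \<odot>\<^bsub>E\<^esub> f) x = scalar_act U M a (f x)"
  using assms by (simp_all add: End_algebra_def)

lemma End_mem [simp]:
  "\<lbrakk>f \<in> carrier E; g \<in> carrier E\<rbrakk> \<Longrightarrow> f \<otimes>\<^bsub>E\<^esub> g \<in> carrier E"
  "\<lbrakk>f \<in> carrier E; g \<in> carrier E\<rbrakk> \<Longrightarrow> f \<oplus>\<^bsub>E\<^esub> g \<in> carrier E"
  "\<one>\<^bsub>E\<^esub> \<in> carrier E" "\<zero>\<^bsub>E\<^esub> \<in> carrier E"
  "\<lbrakk>a \<in> carrier K; f \<in> carrier E\<rbrakk> \<Longrightarrow> a \<odot>\<^bsub>E\<^esub> f \<in> carrier E"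
proof -
  have ops: "f \<otimes>\<^bsub>E\<^esub> g = (\<lambda>x\<in>carrier M. f (g x))"
    "f \<oplus>\<^bsub>E\<^esub> g = (\<lambda>x\<in>carrier M. f x \<oplus>\<^bsub>M\<^esub> g x)"
    "\<one>\<^bsub>E\<^esub> = (\<lambda>x\<in>carrier M. x)" "\<zero>\<^bsub>E\<^esub> = (\<lambda>x\<in>carrier M. \<zero>\<^bsub>M\<^esub>)"
    "a \<odot>\<^bsub>E\<^esub> f = (\<lambda>x\<in>carrier M. scalar_act U M a (f x))"
    by (simp_all add: End_algebra_def)
  show "f \<otimes>\<^bsub>E\<^esub> g \<in> carrier E" if "f \<in> carrier E" "g \<in> carrier E"
    unfolding ops using that by (intro End_memI) (simp_all add: End_hom_add End_hom_act)
  show "f \<oplus>\<^bsub>E\<^esub> g \<in> carrier E" if "f \<in> carrier E" "g \<in> carrier E"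
    unfolding ops using that
    by (intro End_memI) (simp_all add: End_hom_add End_hom_act LM.act_r_distr LM.M.a_ac)
  show "\<one>\<^bsub>E\<^esub> \<in> carrier E" "\<zero>\<^bsub>E\<^esub> \<in> carrier E"
    unfolding ops by (intro End_memI; simp)+
  show "a \<odot>\<^bsub>E\<^esub> f \<in> carrier E" if "a \<in> carrier K" "f \<in> carrier E"
    unfolding ops using that
    by (intro End_memI) (simp_all add: End_hom_add End_hom_act scalar_r_distr scalar_act_commute)
qed

lemma End_hom_scalar: "\<lbrakk>f \<in> carrier E; a \<in> carrier K; x \<in> carrier M\<rbrakk>
    \<Longrightarrow> f (scalar_act U M a x) = scalar_act U M a (f x)"
  by (simp add: carrier_End hom_scalar)

lemma End_minus:
  assumes "f \<in> carrier E"
  shows "\<exists>g\<in>carrier E. g \<oplus>\<^bsub>E\<^esub> f = \<zero>\<^bsub>E\<^esub>"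
proof -
  have g: "(\<lambda>x\<in>carrier M. \<ominus>\<^bsub>M\<^esub> f x) \<in> carrier E"
    using assms by (intro End_memI) (auto simp: End_hom_add End_hom_act LM.M.minus_add LM.act_minus)
  moreover have "(\<lambda>x\<in>carrier M. \<ominus>\<^bsub>M\<^esub> f x) \<oplus>\<^bsub>E\<^esub> f = \<zero>\<^bsub>E\<^esub>"
    using g assms by (intro End_eqI) (auto simp: LM.M.l_neg)
  ultimately show ?thesis by blast
qed

lemma End_unital_algebra: "unital_algebra K E"
proof -
  have ag: "abelian_group E"
    by (rule abelian_groupI)
      (auto intro!: End_eqI End_minus simp: LM.M.a_ac)
  have ring: "ring E"
    by (rule ringI[OF ag monoidI]) (auto intro!: End_eqI simp: End_hom_add)
  have "module K E"
    by (rule moduleI[OF UA.R.is_cring ag])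
      (auto intro!: End_eqI simp: scalar_l_distr scalar_r_distr scalar_assoc)
  then show ?thesis
    using ring by (intro unital_algebra.intro unital_algebra_axioms.intro)
      (auto intro!: End_eqI simp: End_hom_scalar)
qed

lemma End_finsum_apply:
  assumes "finite S" "f \<in> S \<rightarrow> carrier E" "x \<in> carrier M"
  shows "(\<Oplus>\<^bsub>E\<^esub>s\<in>S. f s) x = (\<Oplus>\<^bsub>M\<^esub>s\<in>S. f s x)"
proof -
  interpret EA: unital_algebra K E by (rule End_unital_algebra)
  show ?thesis using assms(1,2)
  proof (induction S)
    case (insert s S)
    then have "f s \<in> carrier E" "f \<in> S \<rightarrow> carrier E" by auto
    moreover from this have "(\<lambda>s. f s x) \<in> S \<rightarrow> carrier M"
      using assms(3) by (auto simp: Pi_def)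
    ultimately show ?case using insert assms(3) by simp
  qed (use assms(3) in simp)
qed

end

lemma (in left_module) submodule_left_module:
  assumes "left_submodule U M N"
  shows "left_module U (M\<lparr>carrier := N\<rparr>)"
proof -
  interpret N: additive_subgroup N M using assms by (simp add: left_submodule_def)
  have sub: "x \<in> carrier M" if "x \<in> N" for x using that N.a_subset by blast
  have "\<exists>y\<in>N. y \<oplus>\<^bsub>M\<^esub> x = \<zero>\<^bsub>M\<^esub>" if "x \<in> N" for x
    using M.l_neg[OF sub[OF that]] N.a_inv_closed[OF that] by blast
  then have "abelian_group (M\<lparr>carrier := N\<rparr>)"
    using N.a_closed N.zero_closed
    by (intro abelian_groupI) (simp_all add: sub M.a_ac)
  moreover have "u \<odot>\<^bsub>M\<^esub> x \<in> N" if "u \<in> carrier U" "x \<in> N" for u x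
    using assms that by (simp add: left_submodule_def)
  ultimately show ?thesis
    by (intro left_module.intro left_module_axioms.intro U.ring_axioms)
      (auto simp: sub act_l_distr act_r_distr act_assoc act_one)
qed

section \<open>Decompositions of a module\<close>

lemma (in left_module) module_hom_inv_into:
  assumes f: "f \<in> module_hom U M N" and bij: "bij_betw f (carrier M) (carrier N)"
  shows "inv_into (carrier M) f \<in> module_hom U N M"
proof -
  let ?g = "inv_into (carrier M) f"
  have g: "?g y \<in> carrier M" "f (?g y) = y" if "y \<in> carrier N" for y
    using that bij by (auto simp: bij_betw_def f_inv_into_f intro: inv_into_into)
  have gf: "?g (f x) = x" if "x \<in> carrier M" for x
    using that bij by (auto simp: bij_betw_def)
  have "?g (y \<oplus>\<^bsub>N\<^esub> z) = ?g y \<oplus>\<^bsub>M\<^esub> ?g z" if "y \<in> carrier N" "z \<in> carrier N" for y z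
    using gf[of "?g y \<oplus>\<^bsub>M\<^esub> ?g z"] g that by (simp add: module_hom_add[OF f])
  moreover have "?g (w \<odot>\<^bsub>N\<^esub> y) = w \<odot>\<^bsub>M\<^esub> ?g y" if "w \<in> carrier U" "y \<in> carrier N" for w y
    using gf[of "w \<odot>\<^bsub>M\<^esub> ?g y"] g that by (simp add: module_hom_smult[OF f] act_closed)
  ultimately show ?thesis using g(1) by (auto simp: module_hom_def)
qed

lemma (in left_module) module_isomorphic_sym:
  assumes "module_isomorphic U M N"
  shows "module_isomorphic U N M"
  using assms module_hom_inv_into bij_betw_inv_into
  unfolding module_isomorphic_def by blast

lemma module_isomorphic_refl: "module_isomorphic U M M"
  unfolding module_isomorphic_def by (rule bexI[of _ id]) (auto simp: module_hom_def)

lemma module_isomorphic_trans: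
  assumes "module_isomorphic U M N" and "module_isomorphic U N P"
  shows "module_isomorphic U M P"
proof -
  obtain f g where f: "f \<in> module_hom U M N" "bij_betw f (carrier M) (carrier N)"
    and g: "g \<in> module_hom U N P" "bij_betw g (carrier N) (carrier P)"
    using assms unfolding module_isomorphic_def by blast
  have "g \<circ> f \<in> module_hom U M P"
    using f(1) g(1) by (auto simp: module_hom_def Pi_def)
  then show ?thesis
    using bij_betw_trans[OF f(2) g(2)] unfolding module_isomorphic_def by blast
qed

section \<open>Components and projections of a direct sum\<close>

locale module_decomposition = algebra_module K U M
  for K :: "('b, 'k) ring_scheme" and U :: "('b, 'u, 'x) module_scheme"
    and M :: "('u, 'c, 'y) module_scheme" +
  fixes n :: nat and N :: "nat \<Rightarrow> 'c set"
  assumes submodule: "j < n \<Longrightarrow> left_submodule U M (N j)"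
    and sum_bij: "bij_betw (\<lambda>x. finsum M x {..<n}) (\<Pi>\<^sub>E j\<in>{..<n}. N j) (carrier M)"
begin

abbreviation "part j \<equiv> M\<lparr>carrier := N j\<rparr>"

definition component :: "'c \<Rightarrow> nat \<Rightarrow> 'c" where
  "component m = inv_into (\<Pi>\<^sub>E j\<in>{..<n}. N j) (\<lambda>x. finsum M x {..<n}) m"

definition proj :: "nat \<Rightarrow> 'c \<Rightarrow> 'c" where
  "proj j = (\<lambda>m\<in>carrier M. component m j)"

lemma part_algebra_module: "j < n \<Longrightarrow> algebra_module K U (part j)"
  using UA.unital_algebra_axioms LM.submodule_left_module[OF submodule]
  by (intro algebra_module.intro)

lemma N_carrier: "\<lbrakk>j < n; x \<in> N j\<rbrakk> \<Longrightarrow> x \<in> carrier M"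
  using submodule[of j] additive_subgroup.a_subset[of "N j" M] by (auto simp: left_submodule_def)

lemma N_zero: "j < n \<Longrightarrow> \<zero>\<^bsub>M\<^esub> \<in> N j"
  using submodule[of j] by (auto simp: left_submodule_def additive_subgroup.zero_closed)

lemma N_add: "\<lbrakk>j < n; x \<in> N j; y \<in> N j\<rbrakk> \<Longrightarrow> x \<oplus>\<^bsub>M\<^esub> y \<in> N j"
  using submodule[of j] by (auto simp: left_submodule_def additive_subgroup.a_closed)

lemma N_act: "\<lbrakk>j < n; w \<in> carrier U; x \<in> N j\<rbrakk> \<Longrightarrow> w \<odot>\<^bsub>M\<^esub> x \<in> N j"
  using submodule[of j] by (auto simp: left_submodule_def)

lemma component_mem: "\<lbrakk>j < n; m \<in> carrier M\<rbrakk> \<Longrightarrow> component m j \<in> N j"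
  using bij_betwE[OF bij_betw_inv_into[OF sum_bij]] unfolding component_def by blast

lemma component_sum: "m \<in> carrier M \<Longrightarrow> finsum M (component m) {..<n} = m"
  using bij_betw_inv_into_right[OF sum_bij] unfolding component_def by blast

text \<open>Identities between components are derived from this: it is enough to exhibit a family
  with the right sum. The restriction in the proof is due to \<open>sum_bij\<close>, whose domain
  consists of extensional families.\<close>

lemma component_unique:
  assumes x: "\<And>j. j < n \<Longrightarrow> x j \<in> N j" and "finsum M x {..<n} = m" and j: "j < n"
  shows "component m j = x j"
proof -
  have "finsum M (restrict x {..<n}) {..<n} = m"
    unfolding assms(2)[symmetric] using x N_carrier by (intro LM.M.add.finprod_cong') auto
  moreover have "restrict x {..<n} \<in> (\<Pi>\<^sub>E j\<in>{..<n}. N j)" using x by auto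
  ultimately have "component m = restrict x {..<n}"
    using bij_betw_inv_into_left[OF sum_bij] unfolding component_def by blast
  then show ?thesis using j by simp
qed

lemma proj_mem: "\<lbrakk>j < n; m \<in> carrier M\<rbrakk> \<Longrightarrow> proj j m \<in> N j"
  by (simp add: proj_def component_mem)

lemma component_Pi: "m \<in> carrier M \<Longrightarrow> component m \<in> {..<n} \<rightarrow> carrier M"
  using component_mem N_carrier by blast

lemma proj_End: 
  assumes j: "j < n"
  shows "proj j \<in> carrier E"
  unfolding proj_def
proof (rule End_memI)
  fix x y assume xy: "x \<in> carrier M" "y \<in> carrier M"
  show "component x j \<in> carrier M" using j xy component_mem N_carrier by blast
  show "component (x \<oplus>\<^bsub>M\<^esub> y) j = component x j \<oplus>\<^bsub>M\<^esub> component y j"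
  proof (rule component_unique[OF _ _ j])
    show "(\<Oplus>\<^bsub>M\<^esub>i\<in>{..<n}. component x i \<oplus>\<^bsub>M\<^esub> component y i) = x \<oplus>\<^bsub>M\<^esub> y"
      using xy by (simp add: LM.M.finsum_addf component_Pi component_sum)
  qed (use xy N_add component_mem in blast)
next
  fix w x assume wx: "w \<in> carrier U" "x \<in> carrier M"
  show "component (w \<odot>\<^bsub>M\<^esub> x) j = w \<odot>\<^bsub>M\<^esub> component x j"
  proof (rule component_unique[OF _ _ j])
    show "(\<Oplus>\<^bsub>M\<^esub>i\<in>{..<n}. w \<odot>\<^bsub>M\<^esub> component x i) = w \<odot>\<^bsub>M\<^esub> x"
      using wx by (simp add: LM.act_finsum[symmetric] component_Pi component_sum)
  qed (use wx N_act component_mem in blast)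
qed

lemma proj_N:
  assumes i: "i < n" and j: "j < n" and m: "m \<in> N i"
  shows "proj j m = (if j = i then m else \<zero>\<^bsub>M\<^esub>)"
proof -
  have mc: "m \<in> carrier M" using N_carrier i m by blast
  have "finsum M (\<lambda>j. if i = j then m else \<zero>\<^bsub>M\<^esub>) {..<n} = m"
    using LM.M.add.finprod_singleton[of i "{..<n}" "\<lambda>_. m"] i mc by simp
  then have "component m j = (if i = j then m else \<zero>\<^bsub>M\<^esub>)"
    using m N_zero by (intro component_unique[OF _ _ j, of "\<lambda>j. if i = j then m else \<zero>\<^bsub>M\<^esub>"]) auto
  then show ?thesis using mc by (auto simp: proj_def)
qed

lemma proj_sum: "m \<in> carrier M \<Longrightarrow> (\<Oplus>\<^bsub>M\<^esub>j\<in>{..<n}. proj j m) = m"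
  using component_sum[of m] by (simp add: proj_def)

lemma proj_carrier [simp]: "\<lbrakk>j < n; m \<in> carrier M\<rbrakk> \<Longrightarrow> proj j m \<in> carrier M"
  using proj_mem N_carrier by blast

text \<open>The residue hypothesis of the theorem speaks of summands with a single complement; the
  complement taken here is the kernel of \<open>proj j\<close>.\<close>

lemma part_direct_summand:
  assumes j: "j < n"
  shows "direct_summand U M (N j)"
  unfolding direct_summand_def complementary_submodules_def
proof (intro exI conjI)
  let ?B = "{m \<in> carrier M. proj j m = \<zero>\<^bsub>M\<^esub>}"
  note pE = proj_End[OF j]
  have minus: "proj j (\<ominus>\<^bsub>M\<^esub> m) = \<ominus>\<^bsub>M\<^esub> proj j m" if m: "m \<in> carrier M" for m
    using End_hom_add[OF pE, of "\<ominus>\<^bsub>M\<^esub> m" m] pE m j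
    by (simp add: LM.M.l_neg LM.M.minus_equality)
  show "left_submodule U M (N j)" using submodule j .
  have "subgroup ?B (add_monoid M)"
  proof (rule subgroup.intro)
    fix x assume "x \<in> ?B"
    then show "inv\<^bsub>add_monoid M\<^esub> x \<in> ?B"
      unfolding a_inv_def[symmetric] using minus by auto
  qed (use pE in \<open>auto simp: End_hom_add\<close>)
  then show "left_submodule U M ?B"
    using pE by (auto simp: left_submodule_def additive_subgroup_def LM.act_closed End_hom_act)
  show "N j \<inter> ?B = {\<zero>\<^bsub>M\<^esub>}"
    using proj_N[OF j j] N_zero[OF j] N_carrier[OF j] by auto
  show "N j <+>\<^bsub>M\<^esub> ?B = carrier M"
  proof
    show "N j <+>\<^bsub>M\<^esub> ?B \<subseteq> carrier M" using N_carrier[OF j] by (auto simp: set_add_def')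
    show "carrier M \<subseteq> N j <+>\<^bsub>M\<^esub> ?B"
    proof
      fix m assume m: "m \<in> carrier M"
      have "proj j (m \<oplus>\<^bsub>M\<^esub> \<ominus>\<^bsub>M\<^esub> proj j m) = \<zero>\<^bsub>M\<^esub>"
        using m j End_hom_add[OF pE, of m "\<ominus>\<^bsub>M\<^esub> proj j m"] minus[of "proj j m"]
          proj_N[OF j j proj_mem[OF j m]] by (simp add: LM.M.r_neg)
      moreover have "m = proj j m \<oplus>\<^bsub>M\<^esub> (m \<oplus>\<^bsub>M\<^esub> \<ominus>\<^bsub>M\<^esub> proj j m)"
        using m j LM.M.a_lcomm[of "proj j m" m "\<ominus>\<^bsub>M\<^esub> proj j m"] by (simp add: LM.M.r_neg)
      moreover have "m \<oplus>\<^bsub>M\<^esub> \<ominus>\<^bsub>M\<^esub> proj j m \<in> carrier M" using m j by simp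
      ultimately show "m \<in> N j <+>\<^bsub>M\<^esub> ?B"
        using proj_mem[OF j m] unfolding set_add_def' by blast
    qed
  qed
qed

text \<open>The compression of \<open>f\<close> to \<open>N j\<close>. It is made extensional on
  \<open>N j\<close> so that it is an element of the endomorphism algebra of the summand.\<close>

definition corner :: "nat \<Rightarrow> ('c \<Rightarrow> 'c) \<Rightarrow> 'c \<Rightarrow> 'c" where
  "corner j f = (\<lambda>x\<in>N j. proj j (f x))"

text \<open>A map between two summands becomes an endomorphism of \<open>M\<close> when it is
  extended by zero on the remaining summands, that is, precomposed with
  \<open>proj i\<close>.\<close>

lemma End_extend:
  assumes i: "i < n" and j: "j < n" and h: "h \<in> module_hom U (part i) (part j)"
  shows "(\<lambda>m\<in>carrier M. h (proj i m)) \<in> carrier E"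
proof (rule End_memI)
  note pE = proj_End[OF i]
  have hc: "h x \<in> N j" if "x \<in> N i" for x
    using module_hom_closed[OF h] that by auto
  fix x assume x: "x \<in> carrier M"
  show "h (proj i x) \<in> carrier M" using hc proj_mem[OF i x] N_carrier[OF j] by blast
  show "h (proj i (x \<oplus>\<^bsub>M\<^esub> y)) = h (proj i x) \<oplus>\<^bsub>M\<^esub> h (proj i y)" if y: "y \<in> carrier M" for y
    using module_hom_add[OF h] proj_mem[OF i x] proj_mem[OF i y] by (simp add: End_hom_add[OF pE x y])
  show "h (proj i (w \<odot>\<^bsub>M\<^esub> x)) = w \<odot>\<^bsub>M\<^esub> h (proj i x)" if w: "w \<in> carrier U" for w
    using module_hom_smult[OF h w] proj_mem[OF i x] by (simp add: End_hom_act[OF pE w x])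
qed

lemma corner_End:
  assumes "j < n" and "f \<in> carrier E"
  shows "corner j f \<in> carrier (End_algebra U (part j))"
proof -
  interpret P: algebra_module K U "part j" by (rule part_algebra_module) fact
  note pE = proj_End[OF assms(1)]
  have "(\<lambda>x\<in>carrier (part j). proj j (f x)) \<in> carrier (End_algebra U (part j))"
  proof (rule P.End_memI; simp)
    fix x assume "x \<in> N j"
    then have x: "x \<in> carrier M" by (rule N_carrier[OF assms(1)])
    show "proj j (f x) \<in> N j" using assms x by (simp add: proj_mem)
    show "proj j (f (x \<oplus>\<^bsub>M\<^esub> y)) = proj j (f x) \<oplus>\<^bsub>M\<^esub> proj j (f y)" if "y \<in> N j" for y
      using assms x N_carrier[OF assms(1) that] pE by (simp add: End_hom_add)
    show "proj j (f (w \<odot>\<^bsub>M\<^esub> x)) = w \<odot>\<^bsub>M\<^esub> proj j (f x)" if "w \<in> carrier U" for w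
      using assms x that pE by (simp add: End_hom_act)
  qed
  then show ?thesis by (simp add: corner_def)
qed

end

section \<open>Compatibility of the corners with the algebra operations\<close>

context module_decomposition
begin

lemma corner_apply [simp]: "x \<in> N j \<Longrightarrow> corner j f x = proj j (f x)"
  by (simp add: corner_def)

lemma corner_add:
  assumes j: "j < n" and f: "f \<in> carrier E" and g: "g \<in> carrier E"
  shows "corner j (f \<oplus>\<^bsub>E\<^esub> g) = corner j f \<oplus>\<^bsub>End_algebra U (part j)\<^esub> corner j g"
proof -
  interpret P: algebra_module K U "part j" by (rule part_algebra_module) fact
  show ?thesis
  proof (rule P.End_eqI)
    fix x assume "x \<in> carrier (part j)"
    then have "x \<in> N j" "x \<in> carrier M" using N_carrier[OF j] by auto
    then show "corner j (f \<oplus>\<^bsub>E\<^esub> g) x = (corner j f \<oplus>\<^bsub>End_algebra U (part j)\<^esub> corner j g) x"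
      using f g by (simp add: End_hom_add[OF proj_End[OF j]])
  qed (simp_all add: corner_End j f g)
qed

lemma corner_smult:
  assumes j: "j < n" and f: "f \<in> carrier E" and a: "a \<in> carrier K"
  shows "corner j (a \<odot>\<^bsub>E\<^esub> f) = a \<odot>\<^bsub>End_algebra U (part j)\<^esub> corner j f"
proof -
  interpret P: algebra_module K U "part j" by (rule part_algebra_module) fact
  show ?thesis
  proof (rule P.End_eqI)
    fix x assume "x \<in> carrier (part j)"
    then have "x \<in> N j" "x \<in> carrier M" using N_carrier[OF j] by auto
    then show "corner j (a \<odot>\<^bsub>E\<^esub> f) x = (a \<odot>\<^bsub>End_algebra U (part j)\<^esub> corner j f) x"
      using f a by (simp add: End_hom_scalar[OF proj_End[OF j]]) (simp add: scalar_act_def)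
  qed (simp_all add: corner_End j f a)
qed

lemma corner_proj:
  assumes j: "j < n"
  shows "corner j (proj j) = \<one>\<^bsub>End_algebra U (part j)\<^esub>"
proof -
  interpret P: algebra_module K U "part j" by (rule part_algebra_module) fact
  show ?thesis
    by (rule P.End_eqI) (simp_all add: corner_End j proj_End proj_N[OF j j])
qed

text \<open>Compression is multiplicative only for composites passing through \<open>N j\<close>;
  the middle \<open>proj j\<close> enforces this.\<close>

lemma corner_mult:
  assumes j: "j < n" and f: "f \<in> carrier E" and g: "g \<in> carrier E"
  shows "corner j (f \<otimes>\<^bsub>E\<^esub> proj j \<otimes>\<^bsub>E\<^esub> g) =
    corner j f \<otimes>\<^bsub>End_algebra U (part j)\<^esub> corner j g"
proof -
  interpret P: algebra_module K U "part j" by (rule part_algebra_module) fact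
  show ?thesis
  proof (rule P.End_eqI)
    fix x assume "x \<in> carrier (part j)"
    then have "x \<in> N j" "x \<in> carrier M" using N_carrier[OF j] by auto
    then show "corner j (f \<otimes>\<^bsub>E\<^esub> proj j \<otimes>\<^bsub>E\<^esub> g) x =
        (corner j f \<otimes>\<^bsub>End_algebra U (part j)\<^esub> corner j g) x"
      using f g j by (simp add: proj_mem)
  qed (simp_all add: corner_End j f g proj_End)
qed

lemma proj_mult: "\<lbrakk>i < n; j < n\<rbrakk> \<Longrightarrow> proj i \<otimes>\<^bsub>E\<^esub> proj j = (if i = j then proj j else \<zero>\<^bsub>E\<^esub>)"
  by (rule End_eqI) (simp_all add: proj_End proj_mem proj_N[of j i])

lemma proj_End_sum: "(\<Oplus>\<^bsub>E\<^esub>j\<in>{..<n}. proj j) = \<one>\<^bsub>E\<^esub>"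
proof -
  interpret EA: unital_algebra K E by (rule End_unital_algebra)
  show ?thesis
    by (rule End_eqI) (auto simp: proj_End End_finsum_apply proj_sum intro!: EA.M.finsum_closed)
qed

end

section \<open>Residues at the summands and the choice of representatives\<close>

locale residue_decomposition = module_decomposition K U M n N + F: field K
  for K :: "('b, 'k) ring_scheme" and U :: "('b, 'u, 'x) module_scheme"
    and M :: "('u, 'c, 'y) module_scheme" and n N +
  fixes \<phi> :: "nat \<Rightarrow> ('c \<Rightarrow> 'c) \<Rightarrow> 'b"
  assumes character: "j < n \<Longrightarrow> residue_character K (End_algebra U (part j)) (\<phi> j)"
begin

lemma phi_closed: "\<lbrakk>j < n; f \<in> carrier (End_algebra U (part j))\<rbrakk> \<Longrightarrow> \<phi> j f \<in> carrier K"
  using character unfolding residue_character_def by blast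

lemma phi_add: "\<lbrakk>j < n; f \<in> carrier (End_algebra U (part j)); g \<in> carrier (End_algebra U (part j))\<rbrakk>
      \<Longrightarrow> \<phi> j (f \<oplus>\<^bsub>End_algebra U (part j)\<^esub> g) = \<phi> j f \<oplus>\<^bsub>K\<^esub> \<phi> j g"
  using character unfolding residue_character_def by blast

lemma phi_mult: "\<lbrakk>j < n; f \<in> carrier (End_algebra U (part j)); g \<in> carrier (End_algebra U (part j))\<rbrakk>
      \<Longrightarrow> \<phi> j (f \<otimes>\<^bsub>End_algebra U (part j)\<^esub> g) = \<phi> j f \<otimes>\<^bsub>K\<^esub> \<phi> j g"
  using character unfolding residue_character_def by blast

lemma phi_smult: "\<lbrakk>j < n; a \<in> carrier K; f \<in> carrier (End_algebra U (part j))\<rbrakk>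
      \<Longrightarrow> \<phi> j (a \<odot>\<^bsub>End_algebra U (part j)\<^esub> f) = a \<otimes>\<^bsub>K\<^esub> \<phi> j f"
  using character unfolding residue_character_def by blast

lemma phi_one: "j < n \<Longrightarrow> \<phi> j \<one>\<^bsub>End_algebra U (part j)\<^esub> = \<one>\<^bsub>K\<^esub>"
  using character unfolding residue_character_def by blast

lemma phi_unit: "\<lbrakk>j < n; f \<in> carrier (End_algebra U (part j)); \<phi> j f \<noteq> \<zero>\<^bsub>K\<^esub>\<rbrakk>
      \<Longrightarrow> \<exists>g\<in>carrier (End_algebra U (part j)). g \<otimes>\<^bsub>End_algebra U (part j)\<^esub> f = \<one>\<^bsub>End_algebra U (part j)\<^esub>"
  using character unfolding residue_character_def by blast

text \<open>The substantial axiom is \<open>psi_unit\<close>: the residue character yields a left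
  inverse \<open>h\<close> of the corner in \<open>End (N j)\<close>, and extending \<open>h\<close>
  by zero gives the required element of \<open>E\<close>.\<close>

lemma local_idempotents_proj: "local_idempotents E K n proj (\<lambda>j f. \<phi> j (corner j f))"
proof -
  have unit: "\<exists>y\<in>carrier E. y \<otimes>\<^bsub>E\<^esub> proj j \<otimes>\<^bsub>E\<^esub> x \<otimes>\<^bsub>E\<^esub> proj j = proj j"
    if j: "j < n" and x: "x \<in> carrier E" and nz: "\<phi> j (corner j x) \<noteq> \<zero>\<^bsub>K\<^esub>" for j x
  proof -
    interpret P: algebra_module K U "part j" by (rule part_algebra_module) fact
    obtain h where h: "h \<in> carrier (End_algebra U (part j))"
      "h \<otimes>\<^bsub>End_algebra U (part j)\<^esub> corner j x = \<one>\<^bsub>End_algebra U (part j)\<^esub>"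
      using phi_unit[OF j corner_End[OF j x] nz] by blast
    define y where "y = (\<lambda>m\<in>carrier M. h (proj j m))"
    have y: "y \<in> carrier E"
      using h(1) End_extend[OF j j] unfolding y_def P.carrier_End by blast
    have "y \<otimes>\<^bsub>E\<^esub> proj j \<otimes>\<^bsub>E\<^esub> x \<otimes>\<^bsub>E\<^esub> proj j = proj j"
    proof (rule End_eqI)
      fix m assume m: "m \<in> carrier M"
      have pm: "proj j m \<in> N j" by (rule proj_mem[OF j m])
      have "h (proj j (x (proj j m))) = (h \<otimes>\<^bsub>End_algebra U (part j)\<^esub> corner j x) (proj j m)"
        using pm by simp
      also have "\<dots> = proj j m" using pm by (simp add: h(2))
      finally show "(y \<otimes>\<^bsub>E\<^esub> proj j \<otimes>\<^bsub>E\<^esub> x \<otimes>\<^bsub>E\<^esub> proj j) m = proj j m"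
        using m j x by (simp add: y_def proj_mem proj_N[OF j j])
    qed (simp_all add: y x proj_End j)
    then show ?thesis using y by blast
  qed
  show ?thesis
    by (intro local_idempotents.intro local_idempotents_axioms.intro End_unital_algebra F.field_axioms unit)
      (simp_all add: proj_End proj_mult proj_End_sum corner_End phi_closed corner_add phi_add
        corner_smult phi_smult corner_proj phi_one corner_mult phi_mult)
qed

sublocale LI: local_idempotents E K n proj "\<lambda>j f. \<phi> j (corner j f)"
  by (rule local_idempotents_proj)

text \<open>One direction restricts \<open>q\<close> and \<open>p\<close> to the summands; the other
  extends an isomorphism and its inverse by zero.\<close>

lemma equivalent_iff_isomorphic:
  assumes i: "i < n" and j: "j < n"
  shows "LI.equivalent_idempotents i j \<longleftrightarrow> module_isomorphic U (part i) (part j)"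
proof
  assume "LI.equivalent_idempotents i j"
  then obtain p q where p: "p \<in> carrier E" "proj i \<otimes>\<^bsub>E\<^esub> p = p"
    and q: "q \<in> carrier E" "proj j \<otimes>\<^bsub>E\<^esub> q = q"
    and pq: "p \<otimes>\<^bsub>E\<^esub> q = proj i" "q \<otimes>\<^bsub>E\<^esub> p = proj j"
    unfolding LI.equivalent_idempotents_def by blast
  have pN: "p m \<in> N i" if "m \<in> carrier M" for m
    using proj_mem[OF i, of "p m"] End_apply(1)[OF that, of "proj i" p] p that by simp
  have qN: "q m \<in> N j" if "m \<in> carrier M" for m
    using proj_mem[OF j, of "q m"] End_apply(1)[OF that, of "proj j" q] q that by simp
  have "q \<in> module_hom U (part i) (part j)"
    using qN N_carrier[OF i] by (simp add: module_hom_def End_hom_add[OF q(1)] End_hom_act[OF q(1)])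
  moreover have "bij_betw q (N i) (N j)"
  proof (rule bij_betw_byWitness[of _ p])
    show "\<forall>x\<in>N i. p (q x) = x"
    proof
      fix x assume x: "x \<in> N i"
      then show "p (q x) = x"
        using End_apply(1)[OF N_carrier[OF i x], of p q] proj_N[OF i i x] by (simp add: pq)
    qed
    show "\<forall>x\<in>N j. q (p x) = x"
    proof
      fix x assume x: "x \<in> N j"
      then show "q (p x) = x"
        using End_apply(1)[OF N_carrier[OF j x], of q p] proj_N[OF j j x] by (simp add: pq)
    qed
    show "q ` N i \<subseteq> N j" using qN N_carrier[OF i] by blast
    show "p ` N j \<subseteq> N i" using pN N_carrier[OF j] by blast
  qed
  ultimately show "module_isomorphic U (part i) (part j)"
    unfolding module_isomorphic_def by auto
next
  assume "module_isomorphic U (part i) (part j)"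
  then obtain f where f: "f \<in> module_hom U (part i) (part j)" "bij_betw f (N i) (N j)"
    unfolding module_isomorphic_def by auto
  define g where "g = inv_into (N i) f"
  interpret P: algebra_module K U "part i" by (rule part_algebra_module) fact
  have g: "g \<in> module_hom U (part j) (part i)"
    using P.LM.module_hom_inv_into[of f "part j"] f by (simp add: g_def)
  have gf: "g (f x) = x" if "x \<in> N i" for x
    using f(2) that by (simp add: g_def bij_betw_inv_into_left)
  have fg: "f (g x) = x" if "x \<in> N j" for x
    using f(2) that by (simp add: g_def bij_betw_inv_into_right)
  have fN: "f x \<in> N j" if "x \<in> N i" for x using f(2) that by (auto simp: bij_betw_def)
  have gN: "g x \<in> N i" if "x \<in> N j" for x using module_hom_closed[OF g] that by auto
  define q where "q = (\<lambda>m\<in>carrier M. f (proj i m))"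
  define p where "p = (\<lambda>m\<in>carrier M. g (proj j m))"
  have qE: "q \<in> carrier E" unfolding q_def by (rule End_extend[OF i j f(1)])
  have pE: "p \<in> carrier E" unfolding p_def by (rule End_extend[OF j i g])
  note mem = fN gN proj_mem[OF i] proj_mem[OF j] N_carrier[OF i] N_carrier[OF j]
  note simps = p_def q_def mem proj_N[OF i i] proj_N[OF j j] fg gf
  have "proj i \<otimes>\<^bsub>E\<^esub> p = p" "p \<otimes>\<^bsub>E\<^esub> proj j = p" "proj j \<otimes>\<^bsub>E\<^esub> q = q" "q \<otimes>\<^bsub>E\<^esub> proj i = q"
    "p \<otimes>\<^bsub>E\<^esub> q = proj i" "q \<otimes>\<^bsub>E\<^esub> p = proj j"
    by ((rule End_eqI; (simp add: pE qE proj_End i j; fail)?), simp add: simps)+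
  then show "LI.equivalent_idempotents i j"
    unfolding LI.equivalent_idempotents_def using pE qE by blast
qed

lemma matrix_frame_exists:
  obtains \<rho> u v where "matrix_frame E K n proj (\<lambda>j f. \<phi> j (corner j f)) \<rho> u v"
    and "\<And>i j. \<lbrakk>i < n; j < n\<rbrakk> \<Longrightarrow> \<rho> i = \<rho> j \<longleftrightarrow> module_isomorphic U (part i) (part j)"
proof -
  define iso where "iso i j \<longleftrightarrow> module_isomorphic U (part i) (part j)" for i j
  \<comment> \<open>Taking the least index makes the representatives of isomorphic summands equal,
    so that \<open>\<rho> i = \<rho> j\<close> decides isomorphism.\<close>
  define \<rho> where "\<rho> j = (LEAST i. i < n \<and> iso i j)" for j
  have refl: "iso j j" for j by (simp add: iso_def module_isomorphic_refl)
  have trans: "iso i k" if "iso i j" "iso j k" for i j k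
    using that module_isomorphic_trans unfolding iso_def by blast
  have sym: "iso j i" if "iso i j" "i < n" for i j
  proof -
    interpret P: algebra_module K U "part i" by (rule part_algebra_module) fact
    show ?thesis using that P.LM.module_isomorphic_sym by (simp add: iso_def)
  qed
  have rho: "\<rho> j < n" "iso (\<rho> j) j" if "j < n" for j
    using LeastI[of "\<lambda>i. i < n \<and> iso i j" j] that refl by (auto simp: \<rho>_def)
  have rho_eq: "\<rho> i = \<rho> j \<longleftrightarrow> iso i j" if ij: "i < n" "j < n" for i j
  proof
    assume "\<rho> i = \<rho> j"
    then show "iso i j" using rho[OF ij(1)] rho[OF ij(2)] sym trans by metis
  next
    assume "iso i j"
    then have "(l < n \<and> iso l i) \<longleftrightarrow> (l < n \<and> iso l j)" for l
      using trans sym ij by blast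
    then show "\<rho> i = \<rho> j" by (simp add: \<rho>_def)
  qed
  have "\<exists>p q. p \<in> carrier E \<and> q \<in> carrier E \<and> p \<otimes>\<^bsub>E\<^esub> proj j = p \<and> proj j \<otimes>\<^bsub>E\<^esub> q = q \<and>
      p \<otimes>\<^bsub>E\<^esub> q = proj (\<rho> j) \<and> q \<otimes>\<^bsub>E\<^esub> p = proj j" if j: "j < n" for j
    using equivalent_iff_isomorphic[OF rho(1)[OF j] j] rho(2)[OF j]
    unfolding LI.equivalent_idempotents_def iso_def by blast
  then obtain u v where uv: "\<And>j. j < n \<Longrightarrow> u j \<in> carrier E \<and> v j \<in> carrier E \<and>
      u j \<otimes>\<^bsub>E\<^esub> proj j = u j \<and> proj j \<otimes>\<^bsub>E\<^esub> v j = v j \<and>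
      u j \<otimes>\<^bsub>E\<^esub> v j = proj (\<rho> j) \<and> v j \<otimes>\<^bsub>E\<^esub> u j = proj j"
    by metis
  have other: "\<phi> (\<rho> a) (corner (\<rho> a) (x \<otimes>\<^bsub>E\<^esub> proj b \<otimes>\<^bsub>E\<^esub> y)) = \<zero>\<^bsub>K\<^esub>"
    if ab: "a < n" "b < n" "\<rho> b \<noteq> \<rho> a" and xy: "x \<in> carrier E" "y \<in> carrier E" for a b x y
  proof (rule ccontr)
    assume "\<not> ?thesis"
    then have "iso (\<rho> a) b"
      using LI.psi_nonzero_imp_equivalent[OF rho(1)[OF ab(1)] ab(2) xy]
        equivalent_iff_isomorphic[OF rho(1)[OF ab(1)] ab(2)] by (simp add: iso_def)
    then have "iso a b" using rho[OF ab(1)] sym trans by blast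
    then show False using rho_eq[OF ab(1,2)] ab(3) by simp
  qed
  have "matrix_frame E K n proj (\<lambda>j f. \<phi> j (corner j f)) \<rho> u v"
    by (intro matrix_frame.intro matrix_frame_axioms.intro local_idempotents_proj other)
      (simp_all add: rho uv)
  then show ?thesis using that rho_eq by (simp add: iso_def)
qed

end

section \<open>The quotient by the radical\<close>

context matrix_frame
begin

text \<open>\<open>\<beta> i\<close> numbers the summands of class \<open>i\<close> by
  \<open>{..<d i}\<close>, which turns the entries of \<open>f\<close> into one matrix per class.
  The map \<open>h\<close> so obtained is a surjective algebra map with kernel
  \<open>entry_kernel\<close>, so the first isomorphism theorem applies.\<close>

lemma quotient_Rad_isomorphic:
  assumes cls: "\<And>j. j < n \<Longrightarrow> cls j \<in> I"
    and cls_eq: "\<And>i j. \<lbrakk>i < n; j < n\<rbrakk> \<Longrightarrow> cls i = cls j \<longleftrightarrow> \<rho> i = \<rho> j"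
    and d: "\<And>i. i \<in> I \<Longrightarrow> d i = card {j. j < n \<and> cls j = i}"
  shows "algebra_isomorphic K (quotient_algebra A (Rad A))
    (direct_sum_algebra I (\<lambda>i. matrix_algebra K (d i)))"
proof -
  let ?D = "direct_sum_algebra I (\<lambda>i. matrix_algebra K (d i))"
  have "\<exists>b. bij_betw b {..<d i} {j. j < n \<and> cls j = i}" if "i \<in> I" for i
    using ex_bij_betw_nat_finite[of "{j. j < n \<and> cls j = i}"] d[OF that]
    by (simp add: atLeast0LessThan)
  then obtain \<beta> where \<beta>: "\<And>i. i \<in> I \<Longrightarrow> bij_betw (\<beta> i) {..<d i} {j. j < n \<and> cls j = i}"
    by metis
  have \<beta>_n [simp]: "\<beta> i r < n" and \<beta>_cls: "cls (\<beta> i r) = i" if "i \<in> I" "r < d i" for i r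
    using bij_betwE[OF \<beta>[OF that(1)]] that(2) by auto
  have \<beta>_rho: "\<rho> (\<beta> i r) = \<rho> (\<beta> i s)" if "i \<in> I" "r < d i" "s < d i" for i r s
    using cls_eq[of "\<beta> i r" "\<beta> i s"] \<beta>_cls that by simp
  have \<beta>_inj: "\<beta> i r = \<beta> i s \<longleftrightarrow> r = s" if "i \<in> I" "r < d i" "s < d i" for i r s
    using \<beta>[OF that(1)] that by (auto simp: bij_betw_def inj_on_def)
  define h where
    "h f = (\<lambda>i\<in>I. \<lambda>(r, s)\<in>{..<d i} \<times> {..<d i}. entry (\<beta> i r) (\<beta> i s) f)" for f
  have h_apply: "h f i (r, s) = entry (\<beta> i r) (\<beta> i s) f" if "i \<in> I" "r < d i" "s < d i" for f i r s
    using that by (simp add: h_def)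
  have PiE_eqI: "F = G"
    if "F \<in> (\<Pi>\<^sub>E i\<in>I. {..<d i} \<times> {..<d i} \<rightarrow>\<^sub>E carrier K)"
      "G \<in> (\<Pi>\<^sub>E i\<in>I. {..<d i} \<times> {..<d i} \<rightarrow>\<^sub>E carrier K)"
      "\<And>i r s. \<lbrakk>i \<in> I; r < d i; s < d i\<rbrakk> \<Longrightarrow> F i (r, s) = G i (r, s)" for F G
  proof (rule PiE_ext[OF that(1,2)])
    fix i assume i: "i \<in> I"
    show "F i = G i"
    proof (rule PiE_ext[OF PiE_mem[OF that(1) i] PiE_mem[OF that(2) i]])
      fix p assume "p \<in> {..<d i} \<times> {..<d i}"
      then show "F i p = G i p" using that(3)[OF i] by (cases p) simp
    qed
  qed
  have h_PiE: "h f \<in> (\<Pi>\<^sub>E i\<in>I. {..<d i} \<times> {..<d i} \<rightarrow>\<^sub>E carrier K)" if "f \<in> carrier A" for f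
    using that by (auto simp: h_def split: if_splits)
  \<comment> \<open>Finite support is automatic: a class met by no summand has
    \<open>d i = 0\<close>, and the only matrix of size 0 is zero.\<close>
  have fin: "finite {i \<in> I. F i \<noteq> \<zero>\<^bsub>matrix_algebra K (d i)\<^esub>}"
    if F: "F \<in> (\<Pi>\<^sub>E i\<in>I. {..<d i} \<times> {..<d i} \<rightarrow>\<^sub>E carrier K)" for F
  proof (rule finite_subset)
    show "{i \<in> I. F i \<noteq> \<zero>\<^bsub>matrix_algebra K (d i)\<^esub>} \<subseteq> cls ` {..<n}"
    proof safe
      fix i assume i: "i \<in> I" and nz: "F i \<noteq> \<zero>\<^bsub>matrix_algebra K (d i)\<^esub>"
      show "i \<in> cls ` {..<n}"
      proof (rule ccontr)
        assume "i \<notin> cls ` {..<n}"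
        then have "{j. j < n \<and> cls j = i} = {}" by auto
        then have "d i = 0" using d[OF i] by simp
        then show False using nz PiE_mem[OF F i] by (auto simp: matrix_algebra_def)
      qed
    qed
  qed simp
  have carrier_D: "carrier ?D = (\<Pi>\<^sub>E i\<in>I. {..<d i} \<times> {..<d i} \<rightarrow>\<^sub>E carrier K)"
    using fin by (auto simp: direct_sum_algebra_def matrix_algebra_def)
  have D_ops: "F \<otimes>\<^bsub>?D\<^esub> G = (\<lambda>i\<in>I. \<lambda>(r, s)\<in>{..<d i} \<times> {..<d i}.
        \<Oplus>\<^bsub>K\<^esub>t\<in>{..<d i}. F i (r, t) \<otimes>\<^bsub>K\<^esub> G i (t, s))"
      "F \<oplus>\<^bsub>?D\<^esub> G = (\<lambda>i\<in>I. \<lambda>p\<in>{..<d i} \<times> {..<d i}. F i p \<oplus>\<^bsub>K\<^esub> G i p)"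
      "\<one>\<^bsub>?D\<^esub> = (\<lambda>i\<in>I. \<lambda>(r, s)\<in>{..<d i} \<times> {..<d i}. if r = s then \<one>\<^bsub>K\<^esub> else \<zero>\<^bsub>K\<^esub>)"
      "\<zero>\<^bsub>?D\<^esub> = (\<lambda>i\<in>I. \<lambda>p\<in>{..<d i} \<times> {..<d i}. \<zero>\<^bsub>K\<^esub>)"
      "c \<odot>\<^bsub>?D\<^esub> F = (\<lambda>i\<in>I. \<lambda>p\<in>{..<d i} \<times> {..<d i}. c \<otimes>\<^bsub>K\<^esub> F i p)" for F G c
    by (simp_all add: direct_sum_algebra_def matrix_algebra_def)
  have mult: "h (f \<otimes> g) = h f \<otimes>\<^bsub>?D\<^esub> h g" if f: "f \<in> carrier A" and g: "g \<in> carrier A" for f g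
  proof -
    have *: "entry (\<beta> i r) (\<beta> i s) (f \<otimes> g) = (\<Oplus>\<^bsub>K\<^esub>t\<in>{..<d i}. h f i (r, t) \<otimes>\<^bsub>K\<^esub> h g i (t, s))"
      if i: "i \<in> I" and rs: "r < d i" "s < d i" for i r s
    proof -
      \<comment> \<open>The indices sharing the representative of \<open>\<beta> i r\<close> are the
        summands of class \<open>i\<close>; reindexing along \<open>\<beta> i\<close> converts the
        sum from \<open>entry_mult\<close> into a matrix product.\<close>
      have T: "{t. t < n \<and> \<rho> t = \<rho> (\<beta> i r)} = \<beta> i ` {..<d i}"
        using bij_betw_imp_surj_on[OF \<beta>[OF i]] cls_eq[of _ "\<beta> i r"] \<beta>_cls[OF i rs(1)] \<beta>_n[OF i rs(1)]
        by auto
      have "entry (\<beta> i r) (\<beta> i s) (f \<otimes> g) =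
          (\<Oplus>\<^bsub>K\<^esub>t\<in>\<beta> i ` {..<d i}. entry (\<beta> i r) t f \<otimes>\<^bsub>K\<^esub> entry t (\<beta> i s) g)"
        unfolding entry_mult[OF \<beta>_n[OF i rs(1)] \<beta>_n[OF i rs(2)] \<beta>_rho[OF i rs] f g] T ..
      also have "\<dots> = (\<Oplus>\<^bsub>K\<^esub>t\<in>{..<d i}. entry (\<beta> i r) (\<beta> i t) f \<otimes>\<^bsub>K\<^esub> entry (\<beta> i t) (\<beta> i s) g)"
        using i rs f g bij_betw_imp_inj_on[OF \<beta>[OF i]] by (intro F.finsum_reindex) auto
      also have "\<dots> = (\<Oplus>\<^bsub>K\<^esub>t\<in>{..<d i}. h f i (r, t) \<otimes>\<^bsub>K\<^esub> h g i (t, s))"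
        using i rs f g by (intro F.add.finprod_cong') (auto simp: h_apply)
      finally show ?thesis .
    qed
    show ?thesis
      unfolding D_ops h_def[of "f \<otimes> g"] using * by (intro restrict_ext) auto
  qed
  have hom: "h \<in> ring_hom A ?D"
  proof (rule ring_hom_memI)
    show "h f \<in> carrier ?D" if "f \<in> carrier A" for f using h_PiE[OF that] by (simp add: carrier_D)
    show "h (f \<otimes> g) = h f \<otimes>\<^bsub>?D\<^esub> h g" if "f \<in> carrier A" "g \<in> carrier A" for f g
      using mult that .
    show "h (f \<oplus> g) = h f \<oplus>\<^bsub>?D\<^esub> h g" if "f \<in> carrier A" "g \<in> carrier A" for f g
      unfolding D_ops h_def[of "f \<oplus> g"] using that
      by (intro restrict_ext) (auto simp: h_apply entry_add)
    have "entry (\<beta> i r) (\<beta> i s) \<one> = (if r = s then \<one>\<^bsub>K\<^esub> else \<zero>\<^bsub>K\<^esub>)"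
      if i: "i \<in> I" and rs: "r < d i" "s < d i" for i r s
      using entry_one[OF \<beta>_n[OF i rs(1)] \<beta>_n[OF i rs(2)] \<beta>_rho[OF i rs]] \<beta>_inj[OF i rs] by simp
    then show "h \<one> = \<one>\<^bsub>?D\<^esub>"
      unfolding D_ops h_def[of \<one>] by (intro restrict_ext) auto
  qed
  have zero: "h \<zero> = \<zero>\<^bsub>?D\<^esub>"
    unfolding D_ops h_def by (intro restrict_ext) auto
  have smult: "h (c \<odot> f) = c \<odot>\<^bsub>?D\<^esub> h f" if "c \<in> carrier K" "f \<in> carrier A" for c f
    unfolding D_ops h_def[of "c \<odot> f"] using that
    by (intro restrict_ext) (auto simp: h_apply entry_smult)
  \<comment> \<open>\<open>\<gamma> a\<close> is the position of summand \<open>a\<close> within its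
    own class. It reads a family of matrices back as scalars on pairs of summands, the input of
    \<open>entry_surj\<close>.\<close>
  define \<gamma> where "\<gamma> a = inv_into {..<d (cls a)} (\<beta> (cls a)) a" for a
  have \<gamma>: "\<gamma> a < d (cls a)" "\<beta> (cls a) (\<gamma> a) = a" if "a < n" for a
    using that bij_betwE[OF bij_betw_inv_into[OF \<beta>[OF cls[OF that]]]]
      bij_betw_inv_into_right[OF \<beta>[OF cls[OF that]]] by (auto simp: \<gamma>_def)
  have \<gamma>_\<beta>: "\<gamma> (\<beta> i r) = r" if "i \<in> I" "r < d i" for i r
    using bij_betw_inv_into_left[OF \<beta>[OF that(1)]] \<beta>_cls that by (simp add: \<gamma>_def)
  have surj: "h ` carrier A = carrier ?D"
  proof
    show "h ` carrier A \<subseteq> carrier ?D" using h_PiE by (auto simp: carrier_D)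
    show "carrier ?D \<subseteq> h ` carrier A"
    proof
      fix F assume "F \<in> carrier ?D"
      then have F: "F \<in> (\<Pi>\<^sub>E i\<in>I. {..<d i} \<times> {..<d i} \<rightarrow>\<^sub>E carrier K)" by (simp add: carrier_D)
      have "F (cls a) (\<gamma> a, \<gamma> b) \<in> carrier K" if "a < n" "b < n" "\<rho> a = \<rho> b" for a b
        using PiE_mem[OF PiE_mem[OF F cls[OF that(1)]], of "(\<gamma> a, \<gamma> b)"]
          \<gamma>(1)[OF that(1)] \<gamma>(1)[OF that(2)] cls_eq[OF that(1,2)] that(3) by simp
      then obtain f where f: "f \<in> carrier A"
        "\<And>a b. \<lbrakk>a < n; b < n; \<rho> a = \<rho> b\<rbrakk> \<Longrightarrow> entry a b f = F (cls a) (\<gamma> a, \<gamma> b)"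
        using entry_surj[of "\<lambda>a b. F (cls a) (\<gamma> a, \<gamma> b)"] by blast
      have "h f = F"
      proof (rule PiE_eqI[OF h_PiE[OF f(1)] F])
        fix i r s assume i: "i \<in> I" and rs: "r < d i" "s < d i"
        show "h f i (r, s) = F i (r, s)"
          using f(2)[OF \<beta>_n[OF i rs(1)] \<beta>_n[OF i rs(2)] \<beta>_rho[OF i rs]] i rs
          by (simp add: h_apply \<beta>_cls \<gamma>_\<beta>)
      qed
      then show "F \<in> h ` carrier A" using f(1) by blast
    qed
  qed
  have "{f \<in> carrier A. h f = \<zero>\<^bsub>?D\<^esub>} = entry_kernel"
  proof (intro equalityI subsetI)
    fix f assume "f \<in> {f \<in> carrier A. h f = \<zero>\<^bsub>?D\<^esub>}"
    then have f: "f \<in> carrier A" "h f = \<zero>\<^bsub>?D\<^esub>" by auto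
    show "f \<in> entry_kernel"
    proof (rule entry_kernelI[OF f(1)])
      fix a b assume ab: "a < n" "b < n" "\<rho> a = \<rho> b"
      then have "cls b = cls a" using cls_eq by simp
      then have "h f (cls a) (\<gamma> a, \<gamma> b) = entry a b f"
        using h_apply[OF cls[OF ab(1)], of "\<gamma> a" "\<gamma> b" f] \<gamma>[OF ab(1)] \<gamma>[OF ab(2)] by simp
      then show "entry a b f = \<zero>\<^bsub>K\<^esub>"
        using f(2) \<gamma>(1)[OF ab(1)] \<gamma>(1)[OF ab(2)] \<open>cls b = cls a\<close> cls[OF ab(1)] by (simp add: D_ops)
    qed
  next
    fix f assume f: "f \<in> entry_kernel"
    have "entry (\<beta> i r) (\<beta> i s) f = \<zero>\<^bsub>K\<^esub>" if i: "i \<in> I" and rs: "r < d i" "s < d i" for i r s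
      by (rule entry_kernelD[OF f \<beta>_n[OF i rs(1)] \<beta>_n[OF i rs(2)] \<beta>_rho[OF i rs]])
    then have "h f = \<zero>\<^bsub>?D\<^esub>"
      unfolding D_ops h_def by (intro restrict_ext) auto
    then show "f \<in> {f \<in> carrier A. h f = \<zero>\<^bsub>?D\<^esub>}" using f by simp
  qed
  then show ?thesis
    using E.quotient_algebra_isomorphic[OF hom surj zero smult] by (simp add: Rad_eq_entry_kernel)
qed

end

section \<open>Existence of decompositions\<close>

text \<open>Negation is the action of \<open>-1\<close> from \<open>U\<close>, once the zero of
  \<open>U\<close> is known to act as zero.\<close>

lemma (in left_module) left_submoduleI:
  assumes "N \<subseteq> carrier M" and "\<zero>\<^bsub>M\<^esub> \<in> N"
    and "\<And>x y. \<lbrakk>x \<in> N; y \<in> N\<rbrakk> \<Longrightarrow> x \<oplus>\<^bsub>M\<^esub> y \<in> N"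
    and "\<And>w x. \<lbrakk>w \<in> carrier U; x \<in> N\<rbrakk> \<Longrightarrow> w \<odot>\<^bsub>M\<^esub> x \<in> N"
  shows "left_submodule U M N"
proof -
  have "\<ominus>\<^bsub>M\<^esub> x \<in> N" if x: "x \<in> N" for x
  proof -
    have xc: "x \<in> carrier M" using x assms(1) by blast
    have z: "\<zero>\<^bsub>U\<^esub> \<odot>\<^bsub>M\<^esub> x = \<zero>\<^bsub>M\<^esub>"
      using act_l_distr[of "\<zero>\<^bsub>U\<^esub>" "\<zero>\<^bsub>U\<^esub>" x] xc act_closed[of "\<zero>\<^bsub>U\<^esub>" x]
      by (simp add: M.add.l_cancel_one')
    have "(\<ominus>\<^bsub>U\<^esub> \<one>\<^bsub>U\<^esub>) \<odot>\<^bsub>M\<^esub> x \<oplus>\<^bsub>M\<^esub> x = (\<ominus>\<^bsub>U\<^esub> \<one>\<^bsub>U\<^esub> \<oplus>\<^bsub>U\<^esub> \<one>\<^bsub>U\<^esub>) \<odot>\<^bsub>M\<^esub> x"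
      using xc by (simp add: act_l_distr act_one)
    also have "\<dots> = \<zero>\<^bsub>M\<^esub>" using z by (simp add: U.l_neg)
    finally have "\<ominus>\<^bsub>M\<^esub> x = (\<ominus>\<^bsub>U\<^esub> \<one>\<^bsub>U\<^esub>) \<odot>\<^bsub>M\<^esub> x"
      using xc by (intro M.minus_equality) (auto simp: act_closed)
    then show ?thesis using assms(4) x by simp
  qed
  then have "subgroup N (add_monoid M)"
    using assms(1-3) by (intro subgroup.intro) (auto simp: a_inv_def)
  then show ?thesis
    using assms(4) by (auto simp: left_submodule_def additive_subgroup_def)
qed

lemma left_submoduleD:
  assumes "left_submodule U M N"
  shows "N \<subseteq> carrier M" "\<zero>\<^bsub>M\<^esub> \<in> N" "\<And>x y. \<lbrakk>x \<in> N; y \<in> N\<rbrakk> \<Longrightarrow> x \<oplus>\<^bsub>M\<^esub> y \<in> N"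
    "\<And>x. x \<in> N \<Longrightarrow> \<ominus>\<^bsub>M\<^esub> x \<in> N" "\<And>w x. \<lbrakk>w \<in> carrier U; x \<in> N\<rbrakk> \<Longrightarrow> w \<odot>\<^bsub>M\<^esub> x \<in> N"
proof -
  interpret additive_subgroup N M using assms by (simp add: left_submodule_def)
  show "N \<subseteq> carrier M" by (rule a_subset)
  show "\<zero>\<^bsub>M\<^esub> \<in> N" by (rule zero_closed)
  show "x \<oplus>\<^bsub>M\<^esub> y \<in> N" if "x \<in> N" "y \<in> N" for x y using a_closed[OF that] .
  show "\<ominus>\<^bsub>M\<^esub> x \<in> N" if "x \<in> N" for x using a_inv_closed[OF that] .
  show "w \<odot>\<^bsub>M\<^esub> x \<in> N" if "w \<in> carrier U" "x \<in> N" for w x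
    using assms that unfolding left_submodule_def by blast
qed

lemma (in left_module) left_submodule_trans:
  assumes "left_submodule U M A" and "left_submodule U (M\<lparr>carrier := A\<rparr>) B"
  shows "left_submodule U M B" and "B \<subseteq> A"
proof -
  note A = left_submoduleD[OF assms(1)] and B = left_submoduleD[OF assms(2), simplified]
  show "B \<subseteq> A" by (rule B(1))
  then have "B \<subseteq> carrier M" using A(1) by (rule subset_trans)
  then show "left_submodule U M B" by (rule left_submoduleI[OF _ B(2,3,5)])
qed

text \<open>Sums and summands of the submodule \<open>A\<close> are taken in the fixed ambient
  \<open>M\<close>, so that decompositions of two submodules can be concatenated. The case
  \<open>A = carrier M\<close> is the notion used in the theorem.\<close>

definition decomposes ::
    "('u, 'x) ring_scheme \<Rightarrow> ('u, 'c) module \<Rightarrow> 'c set \<Rightarrow> nat \<Rightarrow> (nat \<Rightarrow> 'c set) \<Rightarrow> bool" where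
  "decomposes U M A n N \<longleftrightarrow>
    (\<forall>j<n. left_submodule U M (N j) \<and> indecomposable U (M\<lparr>carrier := N j\<rparr>)) \<and>
    bij_betw (\<lambda>x. finsum M x {..<n}) (\<Pi>\<^sub>E j\<in>{..<n}. N j) A"

lemma bij_betw_PiE_append:
  fixes n m :: nat
  defines "Q \<equiv> \<lambda>N P n j. if j < n then N j else P (j - n)"
  shows "bij_betw (\<lambda>x. (restrict x {..<n}, \<lambda>j\<in>{..<m}. x (j + n)))
    (\<Pi>\<^sub>E j\<in>{..<n + m}. Q N P n j) ((\<Pi>\<^sub>E j\<in>{..<n}. N j) \<times> (\<Pi>\<^sub>E j\<in>{..<m}. P j))"
proof (rule bij_betw_byWitness)
  let ?g = "\<lambda>(y, z). \<lambda>j\<in>{..<n + m}. if j < n then y j else z (j - n)"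
  show "\<forall>x\<in>\<Pi>\<^sub>E j\<in>{..<n + m}. Q N P n j. ?g (restrict x {..<n}, \<lambda>j\<in>{..<m}. x (j + n)) = x"
  proof
    fix x assume x: "x \<in> (\<Pi>\<^sub>E j\<in>{..<n + m}. Q N P n j)"
    show "?g (restrict x {..<n}, \<lambda>j\<in>{..<m}. x (j + n)) = x"
    proof (rule ext)
      fix j
      show "?g (restrict x {..<n}, \<lambda>j\<in>{..<m}. x (j + n)) j = x j"
        using PiE_arb[OF x, of j] by (cases "j < n + m") (auto simp: not_less less_diff_conv2)
    qed
  qed
  show "\<forall>p\<in>(\<Pi>\<^sub>E j\<in>{..<n}. N j) \<times> (\<Pi>\<^sub>E j\<in>{..<m}. P j).
      (restrict (?g p) {..<n}, \<lambda>j\<in>{..<m}. ?g p (j + n)) = p"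
  proof
    fix p assume "p \<in> (\<Pi>\<^sub>E j\<in>{..<n}. N j) \<times> (\<Pi>\<^sub>E j\<in>{..<m}. P j)"
    then obtain y z where p: "p = (y, z)" and y: "y \<in> (\<Pi>\<^sub>E j\<in>{..<n}. N j)" and z: "z \<in> (\<Pi>\<^sub>E j\<in>{..<m}. P j)"
      by blast
    have 1: "restrict (?g (y, z)) {..<n} j = y j" for j
      using PiE_arb[OF y, of j] by (cases "j < n") auto
    have 2: "(\<lambda>j\<in>{..<m}. ?g (y, z) (j + n)) j = z j" for j
      using PiE_arb[OF z, of j] by (cases "j < m") auto
    show "(restrict (?g p) {..<n}, \<lambda>j\<in>{..<m}. ?g p (j + n)) = p"
      unfolding p prod.inject by (intro conjI ext 1 2)
  qed
  show "(\<lambda>x. (restrict x {..<n}, \<lambda>j\<in>{..<m}. x (j + n))) ` (\<Pi>\<^sub>E j\<in>{..<n + m}. Q N P n j)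
      \<subseteq> (\<Pi>\<^sub>E j\<in>{..<n}. N j) \<times> (\<Pi>\<^sub>E j\<in>{..<m}. P j)"
  proof (rule image_subsetI)
    fix x assume x: "x \<in> (\<Pi>\<^sub>E j\<in>{..<n + m}. Q N P n j)"
    have "x j \<in> N j" if "j < n" for j using PiE_mem[OF x, of j] that by (simp add: Q_def)
    moreover have "x (j + n) \<in> P j" if "j < m" for j using PiE_mem[OF x, of "j + n"] that by (simp add: Q_def)
    ultimately show "(restrict x {..<n}, \<lambda>j\<in>{..<m}. x (j + n)) \<in> (\<Pi>\<^sub>E j\<in>{..<n}. N j) \<times> (\<Pi>\<^sub>E j\<in>{..<m}. P j)"
      by simp
  qed
  show "?g ` ((\<Pi>\<^sub>E j\<in>{..<n}. N j) \<times> (\<Pi>\<^sub>E j\<in>{..<m}. P j)) \<subseteq> (\<Pi>\<^sub>E j\<in>{..<n + m}. Q N P n j)"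
  proof (rule image_subsetI)
    fix p assume "p \<in> (\<Pi>\<^sub>E j\<in>{..<n}. N j) \<times> (\<Pi>\<^sub>E j\<in>{..<m}. P j)"
    then obtain y z where p: "p = (y, z)" and y: "y \<in> (\<Pi>\<^sub>E j\<in>{..<n}. N j)" and z: "z \<in> (\<Pi>\<^sub>E j\<in>{..<m}. P j)"
      by blast
    have "(if j < n then y j else z (j - n)) \<in> Q N P n j" if "j < n + m" for j
      using PiE_mem[OF y, of j] PiE_mem[OF z, of "j - n"] that by (simp add: Q_def)
    then show "?g p \<in> (\<Pi>\<^sub>E j\<in>{..<n + m}. Q N P n j)"
      by (simp add: p)
  qed
qed

lemma (in abelian_monoid) finsum_append:
  fixes n m :: nat
  assumes "x \<in> {..<n + m} \<rightarrow> carrier G"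
  shows "finsum G x {..<n + m} = finsum G x {..<n} \<oplus> finsum G (\<lambda>j. x (j + n)) {..<m}"
proof -
  have "finsum G x {..<n + m} = finsum G x ({..<n} \<union> {n..<n + m})"
    by (rule arg_cong[where f = "finsum G x"]) auto
  also have "\<dots> = finsum G x {..<n} \<oplus> finsum G x {n..<n + m}"
    using assms by (intro finsum_Un_disjoint) auto
  also have "finsum G x {n..<n + m} = finsum G x ((\<lambda>j. j + n) ` {..<m})"
    by (rule arg_cong[where f = "finsum G x"])
      (simp add: lessThan_atLeast0 add.commute[of _ n] image_add_atLeastLessThan)
  also have "\<dots> = finsum G (\<lambda>j. x (j + n)) {..<m}"
    using assms by (intro finsum_reindex) auto
  finally show ?thesis .
qed

lemma (in left_module) bij_betw_direct_sum:
  assumes A: "left_submodule U M A" and B: "left_submodule U M B" and AB: "A \<inter> B = {\<zero>\<^bsub>M\<^esub>}"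
  shows "bij_betw (\<lambda>(a, b). a \<oplus>\<^bsub>M\<^esub> b) (A \<times> B) (A <+>\<^bsub>M\<^esub> B)"
  unfolding bij_betw_def
proof
  note dA = left_submoduleD[OF A] and dB = left_submoduleD[OF B]
  show "inj_on (\<lambda>(a, b). a \<oplus>\<^bsub>M\<^esub> b) (A \<times> B)"
  proof (rule inj_onI, clarify)
    fix a b c d assume ab: "a \<in> A" "b \<in> B" "c \<in> A" "d \<in> B" and eq: "a \<oplus>\<^bsub>M\<^esub> b = c \<oplus>\<^bsub>M\<^esub> d"
    have mem: "a \<in> carrier M" "b \<in> carrier M" "c \<in> carrier M" "d \<in> carrier M"
      using ab dA(1) dB(1) by auto
    have "\<ominus>\<^bsub>M\<^esub> c \<oplus>\<^bsub>M\<^esub> a = \<ominus>\<^bsub>M\<^esub> c \<oplus>\<^bsub>M\<^esub> (a \<oplus>\<^bsub>M\<^esub> b) \<oplus>\<^bsub>M\<^esub> \<ominus>\<^bsub>M\<^esub> b"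
      using mem by (simp add: M.a_assoc M.r_neg)
    also have "\<dots> = d \<oplus>\<^bsub>M\<^esub> \<ominus>\<^bsub>M\<^esub> b"
      unfolding eq using mem by (simp add: M.r_neg1)
    \<comment> \<open>The left side lies in \<open>A\<close> and the right side in \<open>B\<close>,
      so the common value lies in the trivial intersection.\<close>
    finally have e: "\<ominus>\<^bsub>M\<^esub> c \<oplus>\<^bsub>M\<^esub> a = d \<oplus>\<^bsub>M\<^esub> \<ominus>\<^bsub>M\<^esub> b" .
    have "\<ominus>\<^bsub>M\<^esub> c \<oplus>\<^bsub>M\<^esub> a \<in> A" using ab dA by blast
    moreover have "d \<oplus>\<^bsub>M\<^esub> \<ominus>\<^bsub>M\<^esub> b \<in> B" using ab dB by blast
    ultimately have z: "\<ominus>\<^bsub>M\<^esub> c \<oplus>\<^bsub>M\<^esub> a = \<zero>\<^bsub>M\<^esub>" "d \<oplus>\<^bsub>M\<^esub> \<ominus>\<^bsub>M\<^esub> b = \<zero>\<^bsub>M\<^esub>" using e AB by auto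
    have "a = c" using z(1) mem M.r_neg2[of c a] by simp
    moreover have "b = d" using eq mem unfolding \<open>a = c\<close> by simp
    ultimately show "a = c \<and> b = d" ..
  qed
  show "(\<lambda>(a, b). a \<oplus>\<^bsub>M\<^esub> b) ` (A \<times> B) = A <+>\<^bsub>M\<^esub> B"
    by (auto simp: set_add_def')
qed

text \<open>The sum map of the concatenated family factors into bijections: splitting the family at
  \<open>n\<close>, summing the two pieces separately, and adding the results in the direct sum of
  \<open>A\<close> and \<open>B\<close>.\<close>

lemma decomposes_append:
  assumes M: "left_module U M"
    and A: "left_submodule U M A" and B: "left_submodule U M B" and AB: "A \<inter> B = {\<zero>\<^bsub>M\<^esub>}"
    and N: "decomposes U M A n N" and P: "decomposes U M B m P"
  shows "decomposes U M (A <+>\<^bsub>M\<^esub> B) (n + m) (\<lambda>j. if j < n then N j else P (j - n))"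
proof -
  interpret left_module U M by fact
  let ?Q = "\<lambda>j. if j < n then N j else P (j - n)"
  let ?f = "\<lambda>n x. finsum M x {..<n}"
  let ?g = "\<lambda>x. (restrict x {..<n}, \<lambda>j\<in>{..<m}. x (j + n))"
  have Q: "left_submodule U M (?Q j) \<and> indecomposable U (M\<lparr>carrier := ?Q j\<rparr>)" if "j < n + m" for j
    using N P that unfolding decomposes_def by auto
  have bij: "bij_betw ((\<lambda>(a, b). a \<oplus>\<^bsub>M\<^esub> b) \<circ> (map_prod (?f n) (?f m) \<circ> ?g)) (\<Pi>\<^sub>E j\<in>{..<n + m}. ?Q j) (A <+>\<^bsub>M\<^esub> B)"
    using N P by (intro bij_betw_trans[OF bij_betw_trans[OF bij_betw_PiE_append bij_betw_map_prod]
          bij_betw_direct_sum[OF A B AB]]) (auto simp: decomposes_def)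
  have eq: "((\<lambda>(a, b). a \<oplus>\<^bsub>M\<^esub> b) \<circ> (map_prod (?f n) (?f m) \<circ> ?g)) x = ?f (n + m) x"
    if x: "x \<in> (\<Pi>\<^sub>E j\<in>{..<n + m}. ?Q j)" for x
  proof -
    have xc: "x j \<in> carrier M" if "j < n + m" for j
      using PiE_mem[OF x, of j] left_submoduleD(1)[OF conjunct1[OF Q[OF that]]] that by blast
    have "?f n (restrict x {..<n}) = ?f n x"
      using xc by (intro M.add.finprod_cong') auto
    moreover have "?f m (\<lambda>j\<in>{..<m}. x (j + n)) = ?f m (\<lambda>j. x (j + n))"
      using xc by (intro M.add.finprod_cong') auto
    moreover have "?f (n + m) x = ?f n x \<oplus>\<^bsub>M\<^esub> ?f m (\<lambda>j. x (j + n))"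
      using xc by (intro M.finsum_append) auto
    ultimately show ?thesis by simp
  qed
  have "bij_betw (?f (n + m)) (\<Pi>\<^sub>E j\<in>{..<n + m}. ?Q j) (A <+>\<^bsub>M\<^esub> B)"
    by (rule iffD1[OF bij_betw_cong bij]) (rule eq)
  then show ?thesis using Q unfolding decomposes_def by blast
qed

lemma decomposes_zero:
  assumes "left_module U M"
  shows "decomposes U M {\<zero>\<^bsub>M\<^esub>} 0 N"
proof -
  interpret left_module U M by fact
  show ?thesis by (simp add: decomposes_def bij_betw_def)
qed

lemma decomposes_indecomposable:
  assumes "left_module U M" and A: "left_submodule U M A" and "indecomposable U (M\<lparr>carrier := A\<rparr>)"
  shows "decomposes U M A 1 (\<lambda>_. A)"
proof -
  interpret left_module U M by fact
  have "finsum M x {..<1::nat} = x 0" if "x 0 \<in> A" for x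
    using left_submoduleD(1)[OF A] that by (auto simp: lessThan_Suc)
  then have sum: "finsum M x {..<1::nat} = x 0" if "x \<in> (\<Pi>\<^sub>E j\<in>{..<1::nat}. A)" for x
    using PiE_mem[OF that, of 0] by simp
  have "bij_betw (\<lambda>x. finsum M x {..<1}) (\<Pi>\<^sub>E j\<in>{..<1::nat}. A) A"
  proof (rule bij_betw_byWitness[of _ "\<lambda>a. \<lambda>j\<in>{..<1}. a"])
    show "\<forall>x\<in>\<Pi>\<^sub>E j\<in>{..<1::nat}. A. (\<lambda>j\<in>{..<1}. finsum M x {..<1}) = x"
    proof
      fix x assume x: "x \<in> (\<Pi>\<^sub>E j\<in>{..<1::nat}. A)"
      have "(\<lambda>j\<in>{..<1}. x 0) j = x j" for j
        using PiE_arb[OF x, of j] by (cases "j = 0") auto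
      then show "(\<lambda>j\<in>{..<1}. finsum M x {..<1}) = x" unfolding sum[OF x] by (rule ext)
    qed
    show "\<forall>a\<in>A. finsum M (\<lambda>j\<in>{..<1::nat}. a) {..<1} = a"
    proof
      fix a assume "a \<in> A"
      then have "(\<lambda>j\<in>{..<1::nat}. a) \<in> (\<Pi>\<^sub>E j\<in>{..<1::nat}. A)" by simp
      then show "finsum M (\<lambda>j\<in>{..<1::nat}. a) {..<1} = a" using sum by simp
    qed
    show "(\<lambda>x. finsum M x {..<1}) ` (\<Pi>\<^sub>E j\<in>{..<1::nat}. A) \<subseteq> A"
    proof (rule image_subsetI)
      fix x assume x: "x \<in> (\<Pi>\<^sub>E j\<in>{..<1::nat}. A)"
      show "finsum M x {..<1} \<in> A" unfolding sum[OF x] using PiE_mem[OF x, of 0] by simp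
    qed
    show "(\<lambda>a. \<lambda>j\<in>{..<1}. a) ` A \<subseteq> (\<Pi>\<^sub>E j\<in>{..<1::nat}. A)"
      by (rule image_subsetI) simp
  qed
  then show ?thesis using assms by (simp add: decomposes_def)
qed

text \<open>The inclusions are strict: \<open>B = A\<close> would make \<open>C\<close> equal to
  \<open>B \<inter> C\<close>, hence zero, and symmetrically for \<open>C\<close>. Strictness is
  what makes the induction on dimension terminate.\<close>

lemma (in left_module) not_indecomposable_splits:
  assumes A: "left_submodule U M A" and "A \<noteq> {\<zero>\<^bsub>M\<^esub>}" and "\<not> indecomposable U (M\<lparr>carrier := A\<rparr>)"
  obtains B C where "left_submodule U M B" "left_submodule U M C" "B \<subset> A" "C \<subset> A"
    "B <+>\<^bsub>M\<^esub> C = A" "B \<inter> C = {\<zero>\<^bsub>M\<^esub>}"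
proof -
  have "left_module U (M\<lparr>carrier := A\<rparr>)" by (rule submodule_left_module[OF A])
  then obtain B C where BC: "complementary_submodules U (M\<lparr>carrier := A\<rparr>) B C"
    and nz: "B \<noteq> {\<zero>\<^bsub>M\<^esub>}" "C \<noteq> {\<zero>\<^bsub>M\<^esub>}"
    using assms(2,3) by (auto simp: indecomposable_def)
  have sub: "left_submodule U M B" "left_submodule U M C" "B \<subseteq> A" "C \<subseteq> A"
    using left_submodule_trans[OF A] BC by (auto simp: complementary_submodules_def)
  have sum: "B <+>\<^bsub>M\<^esub> C = A" and int: "B \<inter> C = {\<zero>\<^bsub>M\<^esub>}"
    using BC by (auto simp: complementary_submodules_def set_add_def')
  have "B \<noteq> A" "C \<noteq> A" using nz int sub left_submoduleD(2)[OF sub(1)] left_submoduleD(2)[OF sub(2)] by auto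
  then show ?thesis using that sub sum int by blast
qed

context algebra_module
begin

lemma vectorspace_restrict_scalars:
  assumes "field K"
  shows "vectorspace K (restrict_scalars U M)"
proof -
  interpret F: field K by fact
  have "\<exists>y\<in>carrier M. y \<oplus>\<^bsub>M\<^esub> x = \<zero>\<^bsub>M\<^esub>" if "x \<in> carrier M" for x
    using LM.M.l_neg[OF that] LM.M.a_inv_closed[OF that] by blast
  then have "abelian_group (restrict_scalars U M)"
    by (intro abelian_groupI) (simp_all add: restrict_scalars_def LM.M.a_ac)
  then have "module K (restrict_scalars U M)"
    by (intro moduleI UA.R.is_cring)
      (simp_all add: restrict_scalars_def scalar_l_distr scalar_r_distr scalar_assoc)
  then show ?thesis using assms by (simp add: vectorspace_def)
qed

end

text \<open>The induction is on the maximal size of a linearly independent subset of the submodule.\<close>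

lemma decomposition_exists:
  fixes M :: "('u, 'c) module"
  assumes "field K" and "unital_algebra K U" and M: "left_module U M"
    and fin_dim: "vectorspace.fin_dim K (restrict_scalars U M)"
  shows "\<exists>n N. decomposition_into_indecomposables U M n N"
proof -
  interpret algebra_module K U M using assms by (intro algebra_module.intro)
  let ?V = "restrict_scalars U M"
  have V [simp]: "carrier ?V = carrier M" "\<zero>\<^bsub>?V\<^esub> = \<zero>\<^bsub>M\<^esub>" "add ?V = add M" "smult ?V = scalar_act U M"
    by (simp_all add: restrict_scalars_def)
  interpret V: vectorspace K ?V by (rule vectorspace_restrict_scalars) fact
  have subspace: "submodule K B ?V" if "left_submodule U M B" for B
  proof (rule submodule.intro)
    show "module K ?V" by (rule V.module_axioms)
    show "c \<odot>\<^bsub>?V\<^esub> x \<in> B" if "c \<in> carrier K" "x \<in> B" for c x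
      using left_submoduleD(5)[OF \<open>left_submodule U M B\<close>, of "c \<odot>\<^bsub>U\<^esub> \<one>\<^bsub>U\<^esub>" x] that
      by (simp add: scalar_act_def)
  qed (simp_all add: left_submoduleD(1-3)[OF that])
  \<comment> \<open>This is the dimension of \<open>A\<close>, measured by independent sets of the
    ambient space so that all submodules are compared within one vector space.\<close>
  define \<delta> where "\<delta> A = Max {card S | S. S \<subseteq> A \<and> V.lin_indpt S}" for A
  have bound: "finite S" "card S \<le> V.dim" if "A \<subseteq> carrier M" "S \<subseteq> A" "V.lin_indpt S" for A S
    using V.li_le_dim[OF fin_dim, of S] that by auto
  have fin: "finite {card S | S. S \<subseteq> A \<and> V.lin_indpt S}" if "A \<subseteq> carrier M" for A
    by (rule finite_subset[of _ "{..V.dim}"]) (use bound[OF that] in auto)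
  have "V.lin_indpt {}" by (simp add: V.lin_dep_def)
  then have ne: "{card S | S. S \<subseteq> A \<and> V.lin_indpt S} \<noteq> {}" for A by blast
  have less: "\<delta> B < \<delta> A" if A: "left_submodule U M A" and B: "left_submodule U M B" and BA: "B \<subset> A" for A B
  proof -
    note Ac = left_submoduleD(1)[OF A] and Bc = left_submoduleD(1)[OF B]
    obtain S where S: "S \<subseteq> B" "V.lin_indpt S" "card S = \<delta> B"
      using Max_in[OF fin[OF Bc] ne] unfolding \<delta>_def[symmetric] by auto
    obtain c where c: "c \<in> A" "c \<notin> B" using BA by blast
    have Sc: "S \<subseteq> carrier ?V" and cc: "c \<in> carrier ?V" and cS: "c \<notin> S" using S c Ac Bc by auto
    \<comment> \<open>\<open>B\<close> is a subspace containing \<open>S\<close>, so it contains the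
      span of \<open>S\<close>; adjoining an element outside \<open>B\<close> keeps the set
      independent.\<close>
    have "c \<notin> V.span S" using V.span_is_subset[OF S(1) subspace[OF B]] c(2) by blast
    then have "V.lin_indpt (S \<union> {c})"
      using V.lin_dep_iff_in_span[OF Sc S(2) cc cS] by blast
    moreover have "S \<union> {c} \<subseteq> A" using S(1) BA c(1) by blast
    ultimately have "card (S \<union> {c}) \<le> \<delta> A"
      unfolding \<delta>_def by (intro Max_ge fin[OF Ac]) blast
    then show ?thesis using S(3) cS bound(1)[OF Bc S(1,2)] by simp
  qed
  have "\<exists>n N. decomposes U M A n N" if "left_submodule U M A" for A
    using that
  proof (induction "\<delta> A" arbitrary: A rule: less_induct)
    case less
    show ?case
    proof (cases "A = {\<zero>\<^bsub>M\<^esub>} \<or> indecomposable U (M\<lparr>carrier := A\<rparr>)")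
      case True
      then show ?thesis
        using decomposes_zero[OF M] decomposes_indecomposable[OF M less.prems] by blast
    next
      case False
      then obtain B C where BC: "left_submodule U M B" "left_submodule U M C" "B \<subset> A" "C \<subset> A"
          "B <+>\<^bsub>M\<^esub> C = A" "B \<inter> C = {\<zero>\<^bsub>M\<^esub>}"
        using LM.not_indecomposable_splits[OF less.prems] by blast
      then obtain n N m P where "decomposes U M B n N" "decomposes U M C m P"
        using less.hyps \<open>\<And>A B. \<lbrakk>left_submodule U M A; left_submodule U M B; B \<subset> A\<rbrakk> \<Longrightarrow> \<delta> B < \<delta> A\<close>
          less.prems by metis
      then show ?thesis
        using decomposes_append[OF M BC(1,2,6)] unfolding BC(5) by blast
    qed
  qed
  moreover have "left_submodule U M (carrier M)"
    by (rule LM.left_submoduleI) (auto simp: LM.act_closed)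
  ultimately show ?thesis
    unfolding decomposition_into_indecomposables_def decomposes_def by blast
qed

section \<open>Isomorphism classes and the final isomorphism\<close>

lemma equiv_module_isomorphic:
  "equiv {N. indecomposable U N}
    {(N, N'). indecomposable U N \<and> indecomposable U N' \<and> module_isomorphic U N N'}"
proof (rule equivI)
  show "refl_on {N. indecomposable U N}
      {(N, N'). indecomposable U N \<and> indecomposable U N' \<and> module_isomorphic U N N'}"
    by (auto simp: refl_on_def module_isomorphic_refl)
  show "sym {(N, N'). indecomposable U N \<and> indecomposable U N' \<and> module_isomorphic U N N'}"
    by (auto simp: sym_def indecomposable_def left_module.module_isomorphic_sym)
  show "trans {(N, N'). indecomposable U N \<and> indecomposable U N' \<and> module_isomorphic U N N'}"
    by (auto simp: trans_def intro: module_isomorphic_trans)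
qed auto

lemma quotient_End_Rad_isomorphic:
  fixes k :: "('b, 'k) ring_scheme"
    and U :: "('b, 'u, 'x) module_scheme"
    and M :: "('u, 'c) module"
  assumes k: "field k" and U: "unital_algebra k U" and M: "left_module U M"
    and res: "\<And>M'. direct_summand U M M' \<Longrightarrow> indecomposable U (M\<lparr>carrier := M'\<rparr>) \<Longrightarrow>
          algebra_isomorphic k
            (quotient_algebra (End_algebra U (M\<lparr>carrier := M'\<rparr>))
              (Rad (End_algebra U (M\<lparr>carrier := M'\<rparr>))))
            (base_algebra k)"
    and dec: "decomposition_into_indecomposables U M n N"
  shows "finite {i \<in> indecomposable_classes U. multiplicity_in M n N i \<noteq> 0}"
    and "algebra_isomorphic k
        (quotient_algebra (End_algebra U M) (Rad (End_algebra U M)))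
        (direct_sum_algebra (indecomposable_classes U)
          (\<lambda>i. matrix_algebra k (multiplicity_in M n N i)))"
proof -
  have sub: "left_submodule U M (N j)" and ind: "indecomposable U (M\<lparr>carrier := N j\<rparr>)"
    if "j < n" for j
    using dec that by (auto simp: decomposition_into_indecomposables_def)
  interpret D: module_decomposition k U M n N
    using U M dec
    by (intro module_decomposition.intro algebra_module.intro module_decomposition_axioms.intro)
      (auto simp: decomposition_into_indecomposables_def)
  define R where "R = {(N :: ('u, 'c) module, N' :: ('u, 'c) module).
    indecomposable U N \<and> indecomposable U N' \<and> module_isomorphic U N N'}"
  have R: "equiv {N. indecomposable U N} R"
    unfolding R_def by (rule equiv_module_isomorphic)
  have classes: "indecomposable_classes U = {N. indecomposable U N} // R"
    by (simp add: indecomposable_classes_def R_def)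
  define cls where "cls j = R `` {M\<lparr>carrier := N j\<rparr>}" for j
  have cls: "cls j \<in> indecomposable_classes U" if "j < n" for j
    using ind[OF that] unfolding classes cls_def by (intro quotientI) simp
  \<comment> \<open>\<open>multiplicity_in\<close> counts by membership in a class, the block
    description by equality of classes; disjointness of classes reconciles them.\<close>
  have cls_iff: "M\<lparr>carrier := N j\<rparr> \<in> i \<longleftrightarrow> cls j = i"
    if j: "j < n" and i: "i \<in> indecomposable_classes U" for i j
  proof -
    have "M\<lparr>carrier := N j\<rparr> \<in> cls j"
      using equiv_class_self[OF R] ind[OF j] by (simp add: cls_def)
    then show ?thesis
      using quotient_disj[OF R, of "cls j" i] cls[OF j] i unfolding classes by blast
  qed
  have mult: "multiplicity_in M n N i = card {j. j < n \<and> cls j = i}"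
    if "i \<in> indecomposable_classes U" for i
    unfolding multiplicity_in_def using cls_iff[OF _ that] by (intro arg_cong[of _ _ card]) blast
  show "finite {i \<in> indecomposable_classes U. multiplicity_in M n N i \<noteq> 0}"
  proof (rule finite_subset)
    show "{i \<in> indecomposable_classes U. multiplicity_in M n N i \<noteq> 0} \<subseteq> cls ` {..<n}"
    proof
      fix i assume "i \<in> {i \<in> indecomposable_classes U. multiplicity_in M n N i \<noteq> 0}"
      then have "card {j. j < n \<and> cls j = i} \<noteq> 0" using mult[of i] by force
      then have "{j. j < n \<and> cls j = i} \<noteq> {}" by force
      then show "i \<in> cls ` {..<n}" by blast
    qed
  qed simp
  \<comment> \<open>The residue hypothesis enters here: each \<open>N j\<close> is indecomposable
    and a direct summand, with the kernel of its projection as complement.\<close>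
  have "\<exists>\<phi>. residue_character k (End_algebra U (M\<lparr>carrier := N j\<rparr>)) \<phi>" if j: "j < n" for j
  proof -
    interpret P: algebra_module k U "M\<lparr>carrier := N j\<rparr>" by (rule D.part_algebra_module[OF j])
    show ?thesis
      by (rule unital_algebra.residue_character_exists[OF P.End_unital_algebra k
            res[OF D.part_direct_summand[OF j] ind[OF j]]])
  qed
  then obtain \<phi> where
    "\<And>j. j < n \<Longrightarrow> residue_character k (End_algebra U (M\<lparr>carrier := N j\<rparr>)) (\<phi> j)" by metis
  then interpret RD: residue_decomposition k U M n N \<phi>
    by (intro residue_decomposition.intro residue_decomposition_axioms.intro
        D.module_decomposition_axioms k)
  obtain \<rho> u v where "matrix_frame D.E k n D.proj (\<lambda>j f. \<phi> j (D.corner j f)) \<rho> u v"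
    and rho: "\<And>i j. \<lbrakk>i < n; j < n\<rbrakk> \<Longrightarrow> \<rho> i = \<rho> j \<longleftrightarrow> module_isomorphic U (D.part i) (D.part j)"
    by (rule RD.matrix_frame_exists) blast
  then interpret F: matrix_frame D.E k n D.proj "\<lambda>j f. \<phi> j (D.corner j f)" \<rho> u v by simp
  have "cls i = cls j \<longleftrightarrow> \<rho> i = \<rho> j" if "i < n" "j < n" for i j
    using eq_equiv_class_iff[OF R, of "D.part i" "D.part j"] ind that rho[OF that]
    by (simp add: cls_def) (simp add: R_def)
  then show "algebra_isomorphic k
        (quotient_algebra (End_algebra U M) (Rad (End_algebra U M)))
        (direct_sum_algebra (indecomposable_classes U)
          (\<lambda>i. matrix_algebra k (multiplicity_in M n N i)))"
    using F.quotient_Rad_isomorphic[of cls "indecomposable_classes U" "multiplicity_in M n N"]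
      cls mult by blast
qed

text \<open>The isomorphism is asserted for every decomposition, so it holds whichever one defines
  the multiplicities; the existence clause keeps this assertion from being vacuous.\<close>

theorem theorem5p5:
  fixes k :: "('b, 'k) ring_scheme"
    and U :: "('b, 'u, 'x) module_scheme"
    and M :: "('u, 'c) module"
  assumes "field k"
    and "unital_algebra k U"
    and "left_module U M"
    and "vectorspace.fin_dim k (restrict_scalars U M)"
    and "\<And>M'. direct_summand U M M' \<Longrightarrow> indecomposable U (M\<lparr>carrier := M'\<rparr>) \<Longrightarrow>
          algebra_isomorphic k
            (quotient_algebra (End_algebra U (M\<lparr>carrier := M'\<rparr>))
              (Rad (End_algebra U (M\<lparr>carrier := M'\<rparr>))))
            (base_algebra k)"
  shows "(\<exists>n N. decomposition_into_indecomposables U M n N) \<and>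
    (\<forall>n N. decomposition_into_indecomposables U M n N \<longrightarrow>
      finite {i \<in> indecomposable_classes U. multiplicity_in M n N i \<noteq> 0} \<and>
      algebra_isomorphic k
        (quotient_algebra (End_algebra U M) (Rad (End_algebra U M)))
        (direct_sum_algebra (indecomposable_classes U)
          (\<lambda>i. matrix_algebra k (multiplicity_in M n N i))))"
proof (intro conjI allI impI)
  show "\<exists>n N. decomposition_into_indecomposables U M n N"
    by (rule decomposition_exists[OF assms(1-4)])
  fix n N
  assume "decomposition_into_indecomposables U M n N"
  note quotient_End_Rad_isomorphic[OF assms(1-3) assms(5) this]
  then show "finite {i \<in> indecomposable_classes U. multiplicity_in M n N i \<noteq> 0}"
    and "algebra_isomorphic k
        (quotient_algebra (End_algebra U M) (Rad (End_algebra U M)))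
        (direct_sum_algebra (indecomposable_classes U)
          (\<lambda>i. matrix_algebra k (multiplicity_in M n N i)))"
    by simp_all
qed

end
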